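(* Let $X_1,\ldots,X_n$ be random vectors in $\mathbb{R}^p$ of the form $$X_i=Y_i+R_i\frac{Z_i}{\sqrt{p}},$$ and let $n$ and $p$ tend to infinity. Assume the following. (i) $\mathcal{Y}_n=\{Y_i\}_{i=1}^n$ has joint distribution $P_n$; $\{Z_i\}_{i=1}^n$ are i.i.d. random vectors in $\mathbb{R}^p$ with $\mathbf{E}(Z_i)=0$; $\mathcal{Y}_n$ and $\{Z_i\}_{i=1}^n$ are independent; the $R_i$ are real random variables independent of $\{Z_i\}_{i=1}^n$. (ii) There are constants $C,c_0,b>0$ independent of $p$ such that for every function $F:\mathbb{R}^p\to\mathbb{R}$ that is $1$-Lipschitz with respect to the Euclidean norm, with $\mu_F=\mathbf{E}(F(Z_i))$, one has $P(|F(Z_i)-\mu_F|>r)\le C\exp(-c_0r^b)$ for all $r>0$. (iii) $\nu=\mathbf{E}(\Vert Z_i\Vert_2^2)/p$ stays bounded as $p\to\infty$. (iv) For all $i$, $|R_i|\in[r_\infty(p),R_\infty(p)]$, where $r_\infty(p)$ and $R_\infty(p)$ are deterministic sequences depending on $p$, and (without loss of generality) $R_\infty(p)\ge 1$. (v) With $\mathcal{M}(\mathcal{Y}_n)=\max_{i\ne j}\Vert Y_i-Y_j\Vert_2^2$, there exist deterministic $\mathcal{M}_p$ with $P(\mathcal{M}(\mathcal{Y}_n)\le\mathcal{M}_p)\to1$ and $\varepsilon>0$ such that $$\max\left(\mathcal{M}_p^{1/2},R_\infty(p)\right)\frac{R_\infty(p)\left(\log n+(\log n)^{\varepsilon}\right)^{1/b}}{\sqrt{p}}\to0.$$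 Then $$\max_{i\neq j}\Big|\Vert X_i-X_j\Vert_2^2-\left[\Vert Y_i-Y_j\Vert_2^2+\nu(R_i^2+R_j^2)\right]\Big|\to0\quad\text{in probability}.$$ Moreover, let $\mathcal{W}(\mathcal{Y}_n)=\min_{i\ne j}\Vert Y_i-Y_j\Vert_2^2$ and let $\mathcal{W}_p$ be deterministic such that $P(\mathcal{W}(\mathcal{Y}_n)\ge\mathcal{W}_p)\to1$ (the choice $\mathcal{W}_p=0$ is always possible). For $\eta>0$ let $$I_p(\eta)=\left[\mathcal{W}_p+2\nu r_\infty^2(p)-\eta,\ \mathcal{M}_p+2\nu R_\infty^2(p)+\eta\right],$$ and let $\mathcal{F}_{C_1,I_p(\eta)}$ be the set of functions $f:\mathbb{R}\to\mathbb{R}$ such that $|f(x)-f(y)|\le C_1|x-y|$ for all $x,y\in I_p(\eta)$. For such $f$ let $M_f$ and $\widetilde{M}_f$ be the $n\times n$ matrices with entries $$M_f(i,j)=\frac1nf\left(\Vert X_i-X_j\Vert_2^2\right),\qquad \widetilde{M}_f(i,j)=\begin{cases}\frac1nf\left(\Vert Y_i-Y_j\Vert_2^2+\nu(R_i^2+R_j^2)\right), & i\ne j,\\ \frac1nf(0), & i=j.\end{cases}$$ Then, for any given $C_1>0$ and $\eta>0$, $$\lim_{n,p\to\infty}\ \sup_{f\in\mathcal{F}_{C_1,I_p(\eta)}}\Vert M_f-\widetilde{M}_f\Vert_F=0\quad\text{in probability}.$$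
   Context: $\Vert M\Vert_F$ denotes the Frobenius norm of a matrix and $\Vert v\Vert_2$ the Euclidean norm of a vector. Because the supremum over $f$ may fail to be measurable, its convergence to $0$ in probability means that there is a random variable that dominates it and goes to $0$ in probability (convergence in outer probability). The distributions of the $Y_i$, $Z_i$, $R_i$ may vary with $n$ and $p$. *)

theory Defs
  imports "HOL-Probability.Probability" "Jordan_Normal_Form.Matrix"
begin

text \<open>
  The dimension varies along the sequence, so a vector of \<open>\<real>\<^sup>p\<close> is an extensional
  function on \<open>{..<p}\<close>, and its Euclidean norm is \<^term>\<open>L2_set x {..<p}\<close>.
\<close>

definition Rp :: "nat \<Rightarrow> (nat \<Rightarrow> real) measure" where
  "Rp p = (\<Pi>\<^sub>M j\<in>{..<p}. borel)"

definition lipschitz1 :: "nat \<Rightarrow> ((nat \<Rightarrow> real) \<Rightarrow> real) \<Rightarrow> bool" where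
  "lipschitz1 p F \<longleftrightarrow>
     (\<forall>x\<in>space (Rp p). \<forall>y\<in>space (Rp p). \<bar>F x - F y\<bar> \<le> L2_set (\<lambda>j. x j - y j) {..<p})"

definition sqdist :: "nat \<Rightarrow> (nat \<Rightarrow> real) \<Rightarrow> (nat \<Rightarrow> real) \<Rightarrow> real" where
  "sqdist p x y = (L2_set (\<lambda>j. x j - y j) {..<p})\<^sup>2"

text \<open>
  Maxima and minima over \<open>offdiag n\<close> are unspecified constants for \<open>n < 2\<close>; they are only
  used along \<open>n \<rightarrow> \<infinity>\<close>.
\<close>

definition offdiag :: "nat \<Rightarrow> (nat \<times> nat) set" where
  "offdiag n = {(i, j). i < n \<and> j < n \<and> i \<noteq> j}"

definition max_sqdist :: "nat \<Rightarrow> nat \<Rightarrow> (nat \<Rightarrow> nat \<Rightarrow> real) \<Rightarrow> real" where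
  "max_sqdist n p y = (MAX (i, j)\<in>offdiag n. sqdist p (y i) (y j))"

definition min_sqdist :: "nat \<Rightarrow> nat \<Rightarrow> (nat \<Rightarrow> nat \<Rightarrow> real) \<Rightarrow> real" where
  "min_sqdist n p y = (MIN (i, j)\<in>offdiag n. sqdist p (y i) (y j))"

definition frobenius_norm :: "real mat \<Rightarrow> real" where
  "frobenius_norm A = sqrt (\<Sum>i<dim_row A. \<Sum>j<dim_col A. (A $$ (i, j))\<^sup>2)"

definition kernel_mat ::
  "nat \<Rightarrow> nat \<Rightarrow> (real \<Rightarrow> real) \<Rightarrow> (nat \<Rightarrow> nat \<Rightarrow> real) \<Rightarrow> real mat" where
  "kernel_mat n p f x = mat n n (\<lambda>(i, j). 1 / real n * f (sqdist p (x i) (x j)))"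

definition approx_kernel_mat ::
  "nat \<Rightarrow> nat \<Rightarrow> (real \<Rightarrow> real) \<Rightarrow> real \<Rightarrow> (nat \<Rightarrow> nat \<Rightarrow> real) \<Rightarrow> (nat \<Rightarrow> real) \<Rightarrow> real mat" where
  "approx_kernel_mat n p f v y r = mat n n (\<lambda>(i, j).
     if i \<noteq> j then 1 / real n * f (sqdist p (y i) (y j) + v * ((r i)\<^sup>2 + (r j)\<^sup>2))
     else 1 / real n * f 0)"

text \<open>
  Convergence to \<open>0\<close> in probability. The variables may live on a different probability space
  for each index. In the outer version the dominating variables take values in \<open>[0, \<infinity>]\<close>, since
  a supremum over functions that are only controlled on an interval can be infinite.
\<close>

definition tendsto0_prob :: "(nat \<Rightarrow> 'a measure) \<Rightarrow> (nat \<Rightarrow> 'a \<Rightarrow> real) \<Rightarrow> bool" where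
  "tendsto0_prob M S \<longleftrightarrow>
     (\<forall>k. S k \<in> borel_measurable (M k)) \<and>
     (\<forall>\<delta>>0. (\<lambda>k. measure (M k) {\<omega>\<in>space (M k). \<bar>S k \<omega>\<bar> > \<delta>}) \<longlonglongrightarrow> 0)"

definition tendsto0_outer_prob :: "(nat \<Rightarrow> 'a measure) \<Rightarrow> (nat \<Rightarrow> 'a \<Rightarrow> ennreal) \<Rightarrow> bool" where
  "tendsto0_outer_prob M S \<longleftrightarrow>
     (\<exists>D. (\<forall>k. D k \<in> borel_measurable (M k)) \<and>
          (\<forall>k. \<forall>\<omega>\<in>space (M k). S k \<omega> \<le> D k \<omega>) \<and>
          (\<forall>\<delta>::real. \<delta> > 0 \<longrightarrow>
             (\<lambda>k. measure (M k) {\<omega>\<in>space (M k). D k \<omega> > ennreal \<delta>}) \<longlonglongrightarrow> 0))"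

end

theory Submission
  imports Defs "HOL-Real_Asymp.Real_Asymp"
begin

text \<open>
  Write \<open>h = sqrt p\<close>. Expanding the square gives, for \<open>i \<noteq> j\<close>,
  \<open>|X\<^sub>i - X\<^sub>j|\<^sup>2 = |Y\<^sub>i - Y\<^sub>j|\<^sup>2 + 2 \<langle>Y\<^sub>i - Y\<^sub>j, R\<^sub>i Z\<^sub>i - R\<^sub>j Z\<^sub>j\<rangle> / h
     + (R\<^sub>i\<^sup>2 |Z\<^sub>i|\<^sup>2 + R\<^sub>j\<^sup>2 |Z\<^sub>j|\<^sup>2 - 2 R\<^sub>i R\<^sub>j \<langle>Z\<^sub>i, Z\<^sub>j\<rangle>) / p\<close>.
  The radii enter only through the bound \<open>|R\<^sub>i| \<le> Rmax\<close>; three quantities have to be controlled.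

  \<^item> \<open>\<langle>Y\<^sub>i - Y\<^sub>j, Z\<^sub>i\<rangle>\<close> and \<open>\<langle>Z\<^sub>j, Z\<^sub>i\<rangle>\<close>: here \<open>Z\<^sub>i\<close> is paired with a vector independent of it.
    With that vector fixed, of norm at most \<open>a\<close>, the map \<open>z \<mapsto> \<langle>v, z\<rangle> / a\<close> is
    1-Lipschitz and has mean zero at \<open>Z\<^sub>i\<close>, so by Fubini the concentration hypothesis yields
    \<open>P(|v| \<le> a, |\<langle>v, Z\<^sub>i\<rangle>| > a s) \<le> C exp(-c\<^sub>0 s\<^sup>b)\<close> (lemma \<open>indep_inner_tail\<close>),
    applied with \<open>a = m\<close>, defined below, and with \<open>a = (sqrt \<nu> + 1) h\<close>, respectively.
  \<^item> \<open>|Z\<^sub>i|\<^sup>2 - \<nu> p\<close>: the norm is 1-Lipschitz, so \<open>|Z\<^sub>i|\<close> is within \<open>s\<close> of its mean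
    with the same probability. Summing the tail bounds its variance by a constant
    (lemma \<open>second_moment_le_tail_sum\<close>), so the squared mean is \<open>\<nu> p\<close> up to that constant.

  Let \<open>m = max (sqrt \<M>\<^sub>p) Rmax\<close> and \<open>q = m Rmax s / h\<close>. Where none of the deviations occurs,
  \<open>|Y\<^sub>i - Y\<^sub>j|\<^sup>2 \<le> \<M>\<^sub>p\<close> and \<open>q \<le> 1\<close>, every error is at most a constant times \<open>q\<close>
  (lemma \<open>perturbation_bound\<close>). A union bound over all pairs (lemma \<open>max_gap_tail\<close>), with \<open>s\<close>
  chosen such that \<open>c\<^sub>0 s\<^sup>b = 3 ln n\<close>, makes the exceptional probability at most
  \<open>P(max |Y\<^sub>i - Y\<^sub>j|\<^sup>2 > \<M>\<^sub>p) + 3 C / n\<close>, while the rate hypothesis gives \<open>q \<longlonglongrightarrow> 0\<close>.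

  For the matrices, the diagonals agree. Where the maximal error is at most \<open>\<eta>\<close> and the
  remaining bounds hold, both arguments of \<open>f\<close> in each off-diagonal entry lie in the
  interval, so that each of the \<open>n\<^sup>2\<close> entries differs by at most \<open>C\<^sub>1 / n\<close> times
  the maximal error, and the Frobenius norm of the difference is at most \<open>C\<^sub>1\<close> times it
  (lemma \<open>frobenius_kernel_diff_le\<close>). This bound is uniform in \<open>f\<close>; setting it to \<open>\<infinity>\<close>
  elsewhere gives the dominating random variable.
\<close>

section \<open>Random vectors and 1-Lipschitz functions\<close>

lemma measurable_Rp_component:
  assumes "f \<in> N \<rightarrow>\<^sub>M Rp p" "j < p"
  shows "(\<lambda>\<omega>. f \<omega> j) \<in> borel_measurable N"
  using assms measurable_component_singleton[of j "{..<p}" "\<lambda>_. borel"]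
  unfolding Rp_def by (auto intro: measurable_compose)

lemma measurable_Rp_restrict:
  assumes "\<And>j. j < p \<Longrightarrow> (\<lambda>\<omega>. f \<omega> j) \<in> borel_measurable N"
  shows "(\<lambda>\<omega>. \<lambda>j\<in>{..<p}. f \<omega> j) \<in> N \<rightarrow>\<^sub>M Rp p"
  unfolding Rp_def by (rule measurable_restrict) (use assms in auto)

lemma borel_measurable_L2_set_Rp:
  assumes "\<And>j. j < p \<Longrightarrow> (\<lambda>\<omega>. f \<omega> j) \<in> borel_measurable N"
  shows "(\<lambda>\<omega>. L2_set (f \<omega>) {..<p}) \<in> borel_measurable N"
  unfolding L2_set_def using assms by measurable

lemma borel_measurable_inner_Rp:
  fixes f g :: "'a \<Rightarrow> nat \<Rightarrow> real"
  assumes "\<And>j. j < p \<Longrightarrow> (\<lambda>\<omega>. f \<omega> j) \<in> borel_measurable N"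
    and "\<And>j. j < p \<Longrightarrow> (\<lambda>\<omega>. g \<omega> j) \<in> borel_measurable N"
  shows "(\<lambda>\<omega>. \<Sum>j<p. f \<omega> j * g \<omega> j) \<in> borel_measurable N"
  using assms by (intro borel_measurable_sum borel_measurable_times) auto

lemma abs_inner_le_L2_set:
  "\<bar>\<Sum>j\<in>A. x j * y j\<bar> \<le> L2_set x A * L2_set y A"
proof -
  have "\<bar>\<Sum>j\<in>A. x j * y j\<bar> \<le> (\<Sum>j\<in>A. \<bar>x j\<bar> * \<bar>y j\<bar>)"
    using sum_abs[of "\<lambda>j. x j * y j" A] by (simp add: abs_mult)
  also have "\<dots> \<le> L2_set x A * L2_set y A"
    by (rule L2_set_mult_ineq)
  finally show ?thesis .
qed

lemma lipschitz1_inner: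
  assumes "L2_set v {..<p} \<le> a" "a > 0"
  shows "lipschitz1 p (\<lambda>z. (\<Sum>j<p. v j * z j) / a)"
  unfolding lipschitz1_def
proof (intro ballI)
  fix x y
  have "\<bar>(\<Sum>j<p. v j * x j) - (\<Sum>j<p. v j * y j)\<bar> = \<bar>\<Sum>j<p. v j * (x j - y j)\<bar>"
    by (simp add: sum_subtractf algebra_simps)
  also have "\<dots> \<le> L2_set v {..<p} * L2_set (\<lambda>j. x j - y j) {..<p}"
    by (rule abs_inner_le_L2_set)
  also have "\<dots> \<le> a * L2_set (\<lambda>j. x j - y j) {..<p}"
    using assms by (intro mult_right_mono) auto
  finally show "\<bar>(\<Sum>j<p. v j * x j) / a - (\<Sum>j<p. v j * y j) / a\<bar>
      \<le> L2_set (\<lambda>j. x j - y j) {..<p}"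
    using assms(2) by (simp add: diff_divide_distrib[symmetric] divide_le_eq mult.commute)
qed

lemma lipschitz1_norm: "lipschitz1 p (\<lambda>z. L2_set z {..<p})"
  unfolding lipschitz1_def
proof (intro ballI)
  fix x y :: "nat \<Rightarrow> real"
  have "L2_set x {..<p} \<le> L2_set y {..<p} + L2_set (\<lambda>j. x j - y j) {..<p}"
    using L2_set_triangle_ineq[of y "\<lambda>j. x j - y j" "{..<p}"] by simp
  moreover have "L2_set y {..<p} \<le> L2_set x {..<p} + L2_set (\<lambda>j. y j - x j) {..<p}"
    using L2_set_triangle_ineq[of x "\<lambda>j. y j - x j" "{..<p}"] by simp
  moreover have "L2_set (\<lambda>j. y j - x j) {..<p} = L2_set (\<lambda>j. x j - y j) {..<p}"
    by (simp add: L2_set_def power2_commute)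
  ultimately show "\<bar>L2_set x {..<p} - L2_set y {..<p}\<bar> \<le> L2_set (\<lambda>j. x j - y j) {..<p}"
    by linarith
qed

section \<open>Concentration of inner products and norms\<close>

text \<open>
  Only a tail bound at the single level \<open>s\<close>, for all 1-Lipschitz functions of \<open>W\<close>, is
  assumed. On the event that \<open>V\<close> is longer
  than \<open>a\<close> nothing is claimed; this allows \<open>V\<close> to be unbounded.
\<close>

lemma (in prob_space) indep_inner_tail:
  assumes indep: "indep_var (Rp p) V (Rp p) W"
    and integrable: "\<And>j. j < p \<Longrightarrow> integrable M (\<lambda>\<omega>. W \<omega> j)"
    and mean: "\<And>j. j < p \<Longrightarrow> expectation (\<lambda>\<omega>. W \<omega> j) = 0"
    and conc: "\<And>F. lipschitz1 p F \<Longrightarrow>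
      prob {\<omega>\<in>space M. \<bar>F (W \<omega>) - expectation (\<lambda>\<omega>. F (W \<omega>))\<bar> > s} \<le> Q"
    and a: "a > 0"
  shows "prob {\<omega>\<in>space M. L2_set (V \<omega>) {..<p} \<le> a \<and> a * s < \<bar>\<Sum>j<p. V \<omega> j * W \<omega> j\<bar>} \<le> Q"
proof -
  let ?N = "Rp p"
  have V[measurable]: "V \<in> M \<rightarrow>\<^sub>M ?N" and W[measurable]: "W \<in> M \<rightarrow>\<^sub>M ?N"
    using indep indep_var_rv1 indep_var_rv2 by blast+
  define A where "A = {x\<in>space (?N \<Otimes>\<^sub>M ?N). L2_set (fst x) {..<p} \<le> a
      \<and> a * s < \<bar>\<Sum>j<p. fst x j * snd x j\<bar>}"
  have 1: "(\<lambda>x. fst x j) \<in> borel_measurable (?N \<Otimes>\<^sub>M ?N)"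
    "(\<lambda>x. snd x j) \<in> borel_measurable (?N \<Otimes>\<^sub>M ?N)" if "j < p" for j
    using that by (auto intro: measurable_Rp_component[where p=p])
  have [measurable]: "(\<lambda>x. L2_set (fst x) {..<p}) \<in> borel_measurable (?N \<Otimes>\<^sub>M ?N)"
    "(\<lambda>x. \<Sum>j<p. fst x j * snd x j) \<in> borel_measurable (?N \<Otimes>\<^sub>M ?N)"
    using 1 by (auto intro!: borel_measurable_L2_set_Rp borel_measurable_inner_Rp)
  have A: "A \<in> sets (?N \<Otimes>\<^sub>M ?N)"
    unfolding A_def by measurable
  interpret PV: prob_space "distr M ?N V" by (rule prob_space_distr) (rule V)
  interpret PW: prob_space "distr M ?N W" by (rule prob_space_distr) (rule W)
  have Q0: "0 \<le> Q"
    using conc[OF lipschitz1_norm] measure_nonneg order_trans by blast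
  have "emeasure M {\<omega>\<in>space M. L2_set (V \<omega>) {..<p} \<le> a \<and> a * s < \<bar>\<Sum>j<p. V \<omega> j * W \<omega> j\<bar>}
      = emeasure (distr M (?N \<Otimes>\<^sub>M ?N) (\<lambda>\<omega>. (V \<omega>, W \<omega>))) A"
    using measurable_space[OF V] measurable_space[OF W] A
    by (subst emeasure_distr)
      (auto simp: A_def space_pair_measure intro!: arg_cong[where f="emeasure M"])
  also have "\<dots> = emeasure (distr M ?N V \<Otimes>\<^sub>M distr M ?N W) A"
    using indep by (simp add: indep_var_distribution_eq)
  also have "\<dots> = (\<integral>\<^sup>+v. emeasure (distr M ?N W) (Pair v -` A) \<partial>distr M ?N V)"
    by (rule PW.emeasure_pair_measure_alt) (use A in \<open>simp cong: sets_pair_measure_cong\<close>)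
  also have "\<dots> \<le> (\<integral>\<^sup>+v. ennreal Q \<partial>distr M ?N V)"
  proof (rule nn_integral_mono)
    fix v assume "v \<in> space (distr M ?N V)"
    then have v: "v \<in> space ?N" by simp
    show "emeasure (distr M ?N W) (Pair v -` A) \<le> ennreal Q"
    proof (cases "L2_set v {..<p} \<le> a")
      case False
      then have "Pair v -` A = {}" by (auto simp: A_def)
      then show ?thesis by simp
    next
      case True
      \<comment> \<open>For fixed \<open>v\<close> the centring term in the concentration hypothesis vanishes.\<close>
      have mean0: "expectation (\<lambda>\<omega>. (\<Sum>j<p. v j * W \<omega> j) / a) = 0"
        using integrable mean by simp
      have "emeasure (distr M ?N W) (Pair v -` A)
          = emeasure M {\<omega>\<in>space M. s < \<bar>(\<Sum>j<p. v j * W \<omega> j) / a\<bar>}"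
        using measurable_space[OF W] True v a sets_Pair1[OF A, of v]
        by (subst emeasure_distr)
          (auto simp: A_def space_pair_measure field_simps intro!: arg_cong[where f="emeasure M"])
      also have "\<dots> \<le> ennreal Q"
        using conc[OF lipschitz1_inner[OF True a], unfolded mean0]
        by (simp add: emeasure_eq_measure Q0)
      finally show ?thesis .
    qed
  qed
  also have "\<dots> = ennreal Q"
    using PV.emeasure_space_1 by simp
  finally show ?thesis
    by (simp add: emeasure_eq_measure Q0)
qed

text \<open>
  The function \<open>x\<^sup>2\<close> is dominated by \<open>1\<close> plus the sum over \<open>m\<close> of \<open>(m + 2)\<^sup>2\<close> times the
  indicator of \<open>|x| > m + 1\<close>; integrating term by term gives the bound.
\<close>

lemma (in prob_space) second_moment_le_tail_sum:
  fixes W :: "'a \<Rightarrow> real"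
  assumes W[measurable]: "W \<in> borel_measurable M"
    and tail: "\<And>r. r > 0 \<Longrightarrow> prob {\<omega>\<in>space M. \<bar>W \<omega>\<bar> > r} \<le> g r"
    and summable: "summable (\<lambda>m. (real m + 2)\<^sup>2 * g (real m + 1))"
  shows "expectation (\<lambda>\<omega>. (W \<omega>)\<^sup>2) \<le> 1 + (\<Sum>m. (real m + 2)\<^sup>2 * g (real m + 1))"
proof -
  have g0: "0 \<le> g (real m + 1)" for m
    using tail[of "real m + 1"] measure_nonneg[of M] order_trans
    by (metis add.commute of_nat_0_less_iff of_nat_Suc zero_less_Suc)
  have pointwise: "ennreal ((W \<omega>)\<^sup>2) \<le> 1 + (\<Sum>m. ennreal ((real m + 2)\<^sup>2)
      * indicator {\<omega>\<in>space M. \<bar>W \<omega>\<bar> > real m + 1} \<omega>)" if "\<omega> \<in> space M" for \<omega>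
  proof (cases "\<bar>W \<omega>\<bar> \<le> 1")
    case True
    then have "(W \<omega>)\<^sup>2 \<le> 1" by (simp add: abs_square_le_1)
    then have "ennreal ((W \<omega>)\<^sup>2) \<le> 1" by simp
    then show ?thesis by (rule order_trans) simp
  next
    case False
    \<comment> \<open>The single summand with \<open>m + 1 < |W| \<le> m + 2\<close> already dominates \<open>W\<^sup>2\<close>.\<close>
    define m where "m = nat (\<lceil>\<bar>W \<omega>\<bar>\<rceil> - 2)"
    have m: "real m + 1 < \<bar>W \<omega>\<bar>" "\<bar>W \<omega>\<bar> \<le> real m + 2"
      using False unfolding m_def by linarith+
    have "(W \<omega>)\<^sup>2 \<le> (real m + 2)\<^sup>2"
      using m by (metis abs_ge_zero power2_abs power_mono)
    then have "ennreal ((W \<omega>)\<^sup>2) \<le> ennreal ((real m + 2)\<^sup>2)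
      * indicator {\<omega>\<in>space M. \<bar>W \<omega>\<bar> > real m + 1} \<omega>"
      using m that by (simp add: ennreal_leI)
    also have "\<dots> = (\<Sum>m\<in>{m}. ennreal ((real m + 2)\<^sup>2)
      * indicator {\<omega>\<in>space M. \<bar>W \<omega>\<bar> > real m + 1} \<omega>)"
      by (simp only: sum.insert[OF finite.emptyI] empty_iff not_False_eq_True sum.empty add_0_right)
    also have "\<dots> \<le> (\<Sum>m. ennreal ((real m + 2)\<^sup>2)
      * indicator {\<omega>\<in>space M. \<bar>W \<omega>\<bar> > real m + 1} \<omega>)"
      by (rule sum_le_suminf[OF summableI]) auto
    finally show ?thesis by (rule order_trans) simp
  qed
  have "(\<integral>\<^sup>+\<omega>. ennreal ((W \<omega>)\<^sup>2) \<partial>M) \<le> (\<integral>\<^sup>+\<omega>. 1 + (\<Sum>m. ennreal ((real m + 2)\<^sup>2)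
      * indicator {\<omega>\<in>space M. \<bar>W \<omega>\<bar> > real m + 1} \<omega>) \<partial>M)"
    using pointwise by (rule nn_integral_mono)
  also have "\<dots> = 1 + (\<Sum>m. ennreal ((real m + 2)\<^sup>2)
      * emeasure M {\<omega>\<in>space M. \<bar>W \<omega>\<bar> > real m + 1})"
    by (subst nn_integral_add) (auto simp: nn_integral_suminf nn_integral_cmult emeasure_space_1)
  also have "\<dots> \<le> 1 + (\<Sum>m. ennreal ((real m + 2)\<^sup>2 * g (real m + 1)))"
  proof (intro add_left_mono suminf_le summableI)
    fix m
    show "ennreal ((real m + 2)\<^sup>2) * emeasure M {\<omega>\<in>space M. \<bar>W \<omega>\<bar> > real m + 1}
      \<le> ennreal ((real m + 2)\<^sup>2 * g (real m + 1))"
      using tail[of "real m + 1"] g0[of m]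
      by (simp add: emeasure_eq_measure ennreal_mult[symmetric] mult_left_mono ennreal_leI)
  qed
  also have "\<dots> = ennreal (1 + (\<Sum>m. (real m + 2)\<^sup>2 * g (real m + 1)))"
    using summable g0 by (simp add: suminf_ennreal2 suminf_nonneg)
  finally have "(\<integral>\<^sup>+\<omega>. ennreal ((W \<omega>)\<^sup>2) \<partial>M)
      \<le> ennreal (1 + (\<Sum>m. (real m + 2)\<^sup>2 * g (real m + 1)))" .
  then show ?thesis
    using suminf_nonneg[OF summable] g0
    by (subst integral_eq_nn_integral) (auto intro!: enn2real_leI)
qed

lemma summable_stretched_exp:
  fixes C c b :: real
  assumes "c > 0" "b > 0"
  shows "summable (\<lambda>m. (real m + 2)\<^sup>2 * (C * exp (- c * (real m + 1) powr b)))"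
proof (rule summable_comparison_test_bigo)
  show "summable (\<lambda>m. norm (real m powr - 2))"
    by (simp add: summable_real_powr_iff)
  show "(\<lambda>m. (real m + 2)\<^sup>2 * (C * exp (- c * (real m + 1) powr b))) \<in> O(\<lambda>m. real m powr - 2)"
    using assms by real_asymp
qed

section \<open>Maxima and minima over pairs\<close>

lemma finite_offdiag [simp]: "finite (offdiag n)"
  by (rule finite_subset[of _ "{..<n} \<times> {..<n}"]) (auto simp: offdiag_def)

lemma card_offdiag_le: "card (offdiag n) \<le> n\<^sup>2"
  using card_mono[of "{..<n} \<times> {..<n}" "offdiag n"]
  by (auto simp: offdiag_def power2_eq_square)

lemma offdiag_nonempty:
  assumes "2 \<le> n"
  shows "offdiag n \<noteq> {}"
proof -
  have "(0, 1) \<in> offdiag n" using assms by (simp add: offdiag_def)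
  then show ?thesis by blast
qed

lemma borel_measurable_MAX_offdiag:
  fixes g :: "nat \<Rightarrow> nat \<Rightarrow> 'a \<Rightarrow> real"
  assumes "\<And>i j. (i, j) \<in> offdiag n \<Longrightarrow> g i j \<in> borel_measurable N"
  shows "(\<lambda>\<omega>. MAX (i, j)\<in>offdiag n. g i j \<omega>) \<in> borel_measurable N"
proof -
  have "(\<lambda>\<omega>. Max ((\<lambda>ij. (case ij of (i, j) \<Rightarrow> g i j) \<omega>) ` offdiag n)) \<in> borel_measurable N"
    using assms by (intro borel_measurable_Max) auto
  then show ?thesis
    by (simp add: case_prod_beta)
qed

lemma borel_measurable_MIN_offdiag:
  fixes g :: "nat \<Rightarrow> nat \<Rightarrow> 'a \<Rightarrow> real"
  assumes "\<And>i j. (i, j) \<in> offdiag n \<Longrightarrow> g i j \<in> borel_measurable N"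
  shows "(\<lambda>\<omega>. MIN (i, j)\<in>offdiag n. g i j \<omega>) \<in> borel_measurable N"
proof -
  have "(\<lambda>\<omega>. Min ((\<lambda>ij. (case ij of (i, j) \<Rightarrow> g i j) \<omega>) ` offdiag n)) \<in> borel_measurable N"
    using assms by (intro borel_measurable_Min) auto
  then show ?thesis
    by (simp add: case_prod_beta)
qed

lemma MAX_offdiag_le_iff:
  fixes g :: "nat \<Rightarrow> nat \<Rightarrow> real"
  assumes "2 \<le> n"
  shows "(MAX (i, j)\<in>offdiag n. g i j) \<le> c \<longleftrightarrow> (\<forall>(i, j)\<in>offdiag n. g i j \<le> c)"
  using offdiag_nonempty[OF assms] by (subst Max_le_iff) auto

lemma MIN_offdiag_ge_iff:
  fixes g :: "nat \<Rightarrow> nat \<Rightarrow> real"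
  assumes "2 \<le> n"
  shows "c \<le> (MIN (i, j)\<in>offdiag n. g i j) \<longleftrightarrow> (\<forall>(i, j)\<in>offdiag n. c \<le> g i j)"
  using offdiag_nonempty[OF assms] by (subst Min_ge_iff) auto

section \<open>Perturbation of a squared distance\<close>

lemma L2_set_sq: "(L2_set x A)\<^sup>2 = (\<Sum>j\<in>A. (x j)\<^sup>2)"
  by (simp add: L2_set_def sum_nonneg)

lemma sqdist_perturbed:
  assumes x: "\<And>j. j < p \<Longrightarrow> x j = y j + r * (z j / sqrt (real p))"
    and x': "\<And>j. j < p \<Longrightarrow> x' j = y' j + r' * (z' j / sqrt (real p))"
  shows "sqdist p x x' = sqdist p y y'
    + 2 * r * (\<Sum>j<p. (y j - y' j) * z j) / sqrt (real p)
    - 2 * r' * (\<Sum>j<p. (y j - y' j) * z' j) / sqrt (real p)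
    + (r\<^sup>2 * (L2_set z {..<p})\<^sup>2 + r'\<^sup>2 * (L2_set z' {..<p})\<^sup>2
        - 2 * r * r' * (\<Sum>j<p. z j * z' j)) / real p"
proof -
  have "(x j - x' j)\<^sup>2 = (y j - y' j)\<^sup>2
      + 2 * r / sqrt (real p) * ((y j - y' j) * z j) - 2 * r' / sqrt (real p) * ((y j - y' j) * z' j)
      + (r\<^sup>2 / real p * (z j)\<^sup>2 + r'\<^sup>2 / real p * (z' j)\<^sup>2 - 2 * r * r' / real p * (z j * z' j))"
    if "j < p" for j
  proof -
    define q where "q = sqrt (real p)"
    have q: "q > 0" "real p = q\<^sup>2" using that by (auto simp: q_def)
    show ?thesis
      unfolding x[OF that] x'[OF that] q_def[symmetric] q(2)
      using q(1) by (simp add: field_simps power2_eq_square)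
  qed
  then have "sqdist p x x' = (\<Sum>j<p. (y j - y' j)\<^sup>2
      + 2 * r / sqrt (real p) * ((y j - y' j) * z j) - 2 * r' / sqrt (real p) * ((y j - y' j) * z' j)
      + (r\<^sup>2 / real p * (z j)\<^sup>2 + r'\<^sup>2 / real p * (z' j)\<^sup>2 - 2 * r * r' / real p * (z j * z' j)))"
    unfolding sqdist_def L2_set_sq by (intro sum.cong) auto
  also have "\<dots> = sqdist p y y'
      + 2 * r / sqrt (real p) * (\<Sum>j<p. (y j - y' j) * z j)
      - 2 * r' / sqrt (real p) * (\<Sum>j<p. (y j - y' j) * z' j)
      + (r\<^sup>2 / real p * (L2_set z {..<p})\<^sup>2 + r'\<^sup>2 / real p * (L2_set z' {..<p})\<^sup>2
        - 2 * r * r' / real p * (\<Sum>j<p. z j * z' j))"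
    unfolding sqdist_def L2_set_sq sum_distrib_left by (simp add: sum.distrib sum_subtractf)
  finally show ?thesis
    by (simp add: add_divide_distrib diff_divide_distrib)
qed

text \<open>
  The deterministic core. In the application \<open>m\<close> bounds \<open>|y - y'|\<close>, \<open>s\<close> bounds the deviations
  of 1-Lipschitz functions of the noise, and \<open>V\<close> bounds the variance of its norm. The
  assumptions \<open>1 \<le> s\<close> and \<open>R \<le> m\<close> let the single quantity \<open>m R s / sqrt p\<close> absorb all error terms, including
  \<open>R\<^sup>2 V / p\<close>, and \<open>m R s / sqrt p \<le> 1\<close> lets it absorb its own square.
\<close>

lemma perturbation_bound:
  fixes s m K v V r r' R :: real
  assumes p: "0 < p" and s: "1 \<le> s" and R: "1 \<le> R" "R \<le> m" and v: "0 \<le> v" and V: "0 \<le> V"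
    and q1: "m * R * s / sqrt (real p) \<le> 1"
    and r: "\<bar>r\<bar> \<le> R" and r': "\<bar>r'\<bar> \<le> R"
    and x: "\<And>j. j < p \<Longrightarrow> x j = y j + r * (z j / sqrt (real p))"
    and x': "\<And>j. j < p \<Longrightarrow> x' j = y' j + r' * (z' j / sqrt (real p))"
    and yz: "\<bar>\<Sum>j<p. (y j - y' j) * z j\<bar> \<le> m * s"
    and yz': "\<bar>\<Sum>j<p. (y j - y' j) * z' j\<bar> \<le> m * s"
    and zz': "\<bar>\<Sum>j<p. z j * z' j\<bar> \<le> (sqrt v + 1) * sqrt (real p) * s"
    and z: "\<bar>(L2_set z {..<p})\<^sup>2 - v * real p\<bar> \<le> s * (s + 2 * sqrt (v * real p)) + V"
    and z': "\<bar>(L2_set z' {..<p})\<^sup>2 - v * real p\<bar> \<le> s * (s + 2 * sqrt (v * real p)) + V"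
  shows "\<bar>sqdist p x x' - (sqdist p y y' + v * (r\<^sup>2 + r'\<^sup>2))\<bar>
    \<le> (8 + 6 * sqrt v + 2 * V) * (m * R * s / sqrt (real p))"
proof -
  define h where "h = sqrt (real p)"
  define q where "q = m * R * s / h"
  define a where "a = (\<Sum>j<p. (y j - y' j) * z j)"
  define a' where "a' = (\<Sum>j<p. (y j - y' j) * z' j)"
  define c where "c = (\<Sum>j<p. z j * z' j)"
  define N where "N = (L2_set z {..<p})\<^sup>2"
  define N' where "N' = (L2_set z' {..<p})\<^sup>2"
  define T where "T = s * (s + 2 * sqrt v * h) + V"
  have h: "1 \<le> h" "real p = h\<^sup>2"
    using p by (auto simp: h_def)
  have m: "1 \<le> m" using R by simp
  have T0: "0 \<le> T" unfolding T_def using s v V h by auto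
  have eq: "sqdist p x x' - (sqdist p y y' + v * (r\<^sup>2 + r'\<^sup>2))
      = 2 * (r * a) / h - 2 * (r' * a') / h + r\<^sup>2 * (N - v * real p) / real p
        + r'\<^sup>2 * (N' - v * real p) / real p - 2 * (r * r' * c) / real p"
    unfolding sqdist_perturbed[of p x y r z x' y' r' z', OF x x', simplified]
      a_def[symmetric] a'_def[symmetric] c_def[symmetric] N_def[symmetric] N'_def[symmetric]
      h_def[symmetric]
    using p by (simp add: diff_divide_distrib add_divide_distrib algebra_simps)
  have ra: "\<bar>r * a\<bar> \<le> R * (m * s)" "\<bar>r' * a'\<bar> \<le> R * (m * s)"
    unfolding abs_mult a_def a'_def using r r' yz yz' R by (auto intro!: mult_mono)
  have rc: "\<bar>r * r' * c\<bar> \<le> R * R * ((sqrt v + 1) * h * s)"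
    unfolding abs_mult c_def using r r' zz' R by (auto simp: h_def intro!: mult_mono)
  have r2: "r\<^sup>2 \<le> R\<^sup>2" "r'\<^sup>2 \<le> R\<^sup>2"
    using r r' R by (auto simp: abs_le_square_iff[symmetric])
  have sq: "sqrt (v * real p) = sqrt v * h"
    by (simp add: real_sqrt_mult h_def)
  have rN: "\<bar>r\<^sup>2 * (N - v * real p)\<bar> \<le> R\<^sup>2 * T" "\<bar>r'\<^sup>2 * (N' - v * real p)\<bar> \<le> R\<^sup>2 * T"
    unfolding abs_mult N_def N'_def T_def using r2 z z'
    by (auto simp: sq mult.assoc intro!: mult_mono)
  have tri: "\<bar>t1 - t2 + t3 + t4 - t5\<bar> \<le> \<bar>t1\<bar> + \<bar>t2\<bar> + \<bar>t3\<bar> + \<bar>t4\<bar> + \<bar>t5\<bar>"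
    for t1 t2 t3 t4 t5 :: real by linarith
  have "\<bar>2 * (r * a) / h - 2 * (r' * a') / h + r\<^sup>2 * (N - v * real p) / real p
        + r'\<^sup>2 * (N' - v * real p) / real p - 2 * (r * r' * c) / real p\<bar>
      \<le> \<bar>2 * (r * a) / h\<bar> + \<bar>2 * (r' * a') / h\<bar> + \<bar>r\<^sup>2 * (N - v * real p) / real p\<bar>
        + \<bar>r'\<^sup>2 * (N' - v * real p) / real p\<bar> + \<bar>2 * (r * r' * c) / real p\<bar>"
    by (rule tri)
  also have "\<dots> = 2 * \<bar>r * a\<bar> / h + 2 * \<bar>r' * a'\<bar> / h + \<bar>r\<^sup>2 * (N - v * real p)\<bar> / real p
        + \<bar>r'\<^sup>2 * (N' - v * real p)\<bar> / real p + 2 * \<bar>r * r' * c\<bar> / real p"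
    using h by (simp add: abs_mult)
  also have "\<dots> \<le> 2 * (R * (m * s)) / h + 2 * (R * (m * s)) / h + R\<^sup>2 * T / real p
        + R\<^sup>2 * T / real p + 2 * (R * R * ((sqrt v + 1) * h * s)) / real p"
    using ra rN rc h by (intro add_mono divide_right_mono mult_left_mono) auto
  also have "\<dots> = 4 * q + 2 * (R\<^sup>2 * T / h\<^sup>2) + 2 * (sqrt v + 1) * (R\<^sup>2 * s / h)"
    using h by (simp add: q_def field_simps power2_eq_square)
  finally have main: "\<bar>sqdist p x x' - (sqdist p y y' + v * (r\<^sup>2 + r'\<^sup>2))\<bar>
      \<le> 4 * q + 2 * (R\<^sup>2 * T / h\<^sup>2) + 2 * (sqrt v + 1) * (R\<^sup>2 * s / h)"
    unfolding eq .
  have q0: "0 \<le> q" "q \<le> 1"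
    using m R s h(1) q1 by (auto simp: q_def h_def[symmetric])
  have R2s: "R\<^sup>2 * s / h \<le> q"
    unfolding q_def power2_eq_square using R s h m by (intro divide_right_mono mult_right_mono) auto
  have Rs: "R * s / h \<le> q"
    unfolding q_def using R s h m mult_right_mono[of 1 m "R * s"]
    by (intro divide_right_mono) (auto simp: mult.assoc)
  \<comment> \<open>The term quadratic in \<open>s\<close> is \<open>(R s / h)\<^sup>2\<close>, at most \<open>q\<^sup>2 \<le> q\<close>.\<close>
  have "(R * s / h)\<^sup>2 \<le> q * 1"
    unfolding power2_eq_square
    by (intro mult_mono order_trans[OF Rs q0(2)] Rs q0) (use R s h in auto)
  then have t1: "R\<^sup>2 * s\<^sup>2 / h\<^sup>2 \<le> q"
    by (simp add: power_mult_distrib power_divide)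
  have "(1 / h) / h \<le> s / h"
    using h s by (intro divide_right_mono) (auto intro: order_trans[of _ 1])
  then have "R\<^sup>2 * ((1 / h) / h) \<le> R\<^sup>2 * (s / h)"
    by (rule mult_left_mono) simp
  then have t2: "R\<^sup>2 / h\<^sup>2 \<le> q" using R2s by (simp add: power2_eq_square)
  have "R\<^sup>2 * T / h\<^sup>2 = R\<^sup>2 * s\<^sup>2 / h\<^sup>2 + 2 * sqrt v * (R\<^sup>2 * s / h) + V * (R\<^sup>2 / h\<^sup>2)"
    using h by (simp add: T_def field_simps power2_eq_square)
  also have "\<dots> \<le> q + 2 * sqrt v * q + V * q"
    using t1 t2 R2s v V by (intro add_mono mult_left_mono) auto
  finally have "2 * (R\<^sup>2 * T / h\<^sup>2) \<le> 2 * (q + 2 * sqrt v * q + V * q)" by simp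
  moreover have "2 * (sqrt v + 1) * (R\<^sup>2 * s / h) \<le> 2 * (sqrt v + 1) * q"
    using R2s v by (intro mult_left_mono) auto
  ultimately have "\<bar>sqdist p x x' - (sqdist p y y' + v * (r\<^sup>2 + r'\<^sup>2))\<bar>
      \<le> 4 * q + 2 * (q + 2 * sqrt v * q + V * q) + 2 * (sqrt v + 1) * q"
    using main by linarith
  also have "\<dots> = (8 + 6 * sqrt v + 2 * V) * q"
    by (simp add: algebra_simps)
  finally show ?thesis
    by (simp add: q_def h_def)
qed

section \<open>A tail bound at fixed size\<close>

text \<open>
  The maximal error over pairs \<open>i \<noteq> j\<close> in the approximation of squared distances; \<open>v\<close> stands
  for the normalized second moment of the noise. Unspecified for \<open>n < 2\<close>.
\<close>

definition max_gap :: "nat \<Rightarrow> nat \<Rightarrow> real \<Rightarrow> (nat \<Rightarrow> nat \<Rightarrow> real) \<Rightarrow> (nat \<Rightarrow> nat \<Rightarrow> real)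
    \<Rightarrow> (nat \<Rightarrow> real) \<Rightarrow> real" where
  "max_gap n p v x y r = (MAX (i, j)\<in>offdiag n.
     \<bar>sqdist p (x i) (x j) - (sqdist p (y i) (y j) + v * ((r i)\<^sup>2 + (r j)\<^sup>2))\<bar>)"

text \<open>
  A bound on the second moment of a real random variable whose tails are bounded by \<open>g\<close>,
  meaningful when the series converges.
\<close>

definition tail_moment :: "(real \<Rightarrow> real) \<Rightarrow> real" where
  "tail_moment g = 1 + (\<Sum>m. (real m + 2)\<^sup>2 * g (real m + 1))"

text \<open>
  A sample \<open>X\<close> of size \<open>n\<close> in dimension \<open>p\<close>, consisting of a signal \<open>Y\<close> and of independent
  centred noise \<open>Z\<close>, scaled by bounded random radii \<open>R\<close>. The function \<open>g\<close> bounds the tails of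
  1-Lipschitz functions of the noise, and \<open>v\<close> is the second moment of the noise per
  coordinate. Summability ensures that the tails \<open>g\<close> have a finite second moment.
\<close>

locale perturbed_sample = prob_space M for M :: "'a measure" +
  fixes n p :: nat
    and X Y Z :: "nat \<Rightarrow> 'a \<Rightarrow> nat \<Rightarrow> real"
    and R :: "nat \<Rightarrow> 'a \<Rightarrow> real"
    and v Rmax :: real
    and g :: "real \<Rightarrow> real"
  assumes X_eq: "\<And>i j \<omega>. i < n \<Longrightarrow> j < p \<Longrightarrow> \<omega> \<in> space M \<Longrightarrow>
      X i \<omega> j = Y i \<omega> j + R i \<omega> * (Z i \<omega> j / sqrt (real p))"
    and Y_rv: "\<And>i. i < n \<Longrightarrow> Y i \<in> M \<rightarrow>\<^sub>M Rp p"
    and Z_rv: "\<And>i. i < n \<Longrightarrow> Z i \<in> M \<rightarrow>\<^sub>M Rp p"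
    and R_rv: "\<And>i. i < n \<Longrightarrow> R i \<in> borel_measurable M"
    and Z_indep: "indep_vars (\<lambda>i. Rp p) Z {..<n}"
    and Z_integrable: "\<And>i j. i < n \<Longrightarrow> j < p \<Longrightarrow> integrable M (\<lambda>\<omega>. Z i \<omega> j)"
    and Z_mean: "\<And>i j. i < n \<Longrightarrow> j < p \<Longrightarrow> expectation (\<lambda>\<omega>. Z i \<omega> j) = 0"
    and YZ_indep: "indep_var
          (\<Pi>\<^sub>M i\<in>{..<n}. Rp p) (\<lambda>\<omega>. \<lambda>i\<in>{..<n}. Y i \<omega>)
          (\<Pi>\<^sub>M i\<in>{..<n}. Rp p) (\<lambda>\<omega>. \<lambda>i\<in>{..<n}. Z i \<omega>)"
    and Z_conc: "\<And>i F r. i < n \<Longrightarrow> lipschitz1 p F \<Longrightarrow> r > 0 \<Longrightarrow>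
          prob {\<omega>\<in>space M. \<bar>F (Z i \<omega>) - expectation (\<lambda>\<omega>. F (Z i \<omega>))\<bar> > r} \<le> g r"
    and g_summable: "summable (\<lambda>m. (real m + 2)\<^sup>2 * g (real m + 1))"
    and Z_sq_integrable: "\<And>i. i < n \<Longrightarrow> integrable M (\<lambda>\<omega>. (L2_set (Z i \<omega>) {..<p})\<^sup>2)"
    and Z_sq: "\<And>i. i < n \<Longrightarrow> expectation (\<lambda>\<omega>. (L2_set (Z i \<omega>) {..<p})\<^sup>2) = v * real p"
    and R_le: "\<And>i. i < n \<Longrightarrow> AE \<omega> in M. \<bar>R i \<omega>\<bar> \<le> Rmax"
begin

lemma borel_measurable_coord:
  assumes "i < n" "j < p"
  shows "(\<lambda>\<omega>. Y i \<omega> j) \<in> borel_measurable M" "(\<lambda>\<omega>. Z i \<omega> j) \<in> borel_measurable M"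
    "(\<lambda>\<omega>. X i \<omega> j) \<in> borel_measurable M"
proof -
  show Y: "(\<lambda>\<omega>. Y i \<omega> j) \<in> borel_measurable M" and Z: "(\<lambda>\<omega>. Z i \<omega> j) \<in> borel_measurable M"
    using assms Y_rv Z_rv by (auto intro: measurable_Rp_component)
  have "(\<lambda>\<omega>. Y i \<omega> j + R i \<omega> * (Z i \<omega> j / sqrt (real p))) \<in> borel_measurable M"
    using Y Z R_rv[OF assms(1)] by measurable
  then show "(\<lambda>\<omega>. X i \<omega> j) \<in> borel_measurable M"
    using X_eq assms by (simp cong: measurable_cong)
qed

lemma borel_measurable_sqdist:
  assumes "i < n" "j < n"
  shows "(\<lambda>\<omega>. sqdist p (Y i \<omega>) (Y j \<omega>)) \<in> borel_measurable M"
    "(\<lambda>\<omega>. sqdist p (X i \<omega>) (X j \<omega>)) \<in> borel_measurable M"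
  unfolding sqdist_def using assms
  by (auto intro!: borel_measurable_power borel_measurable_L2_set_Rp borel_measurable_diff
      borel_measurable_coord)

lemma borel_measurable_max_sqdist:
  "(\<lambda>\<omega>. max_sqdist n p (\<lambda>i. Y i \<omega>)) \<in> borel_measurable M"
  unfolding max_sqdist_def
  by (intro borel_measurable_MAX_offdiag borel_measurable_sqdist) (auto simp: offdiag_def)

lemma borel_measurable_min_sqdist:
  "(\<lambda>\<omega>. min_sqdist n p (\<lambda>i. Y i \<omega>)) \<in> borel_measurable M"
  unfolding min_sqdist_def
  by (intro borel_measurable_MIN_offdiag borel_measurable_sqdist) (auto simp: offdiag_def)

lemma borel_measurable_max_gap:
  "(\<lambda>\<omega>. max_gap n p v (\<lambda>i. X i \<omega>) (\<lambda>i. Y i \<omega>) (\<lambda>i. R i \<omega>)) \<in> borel_measurable M"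
  unfolding max_gap_def
proof (rule borel_measurable_MAX_offdiag)
  fix i j assume "(i, j) \<in> offdiag n"
  then have ij: "i < n" "j < n" by (auto simp: offdiag_def)
  note [measurable] = borel_measurable_sqdist[OF ij] R_rv[OF ij(1)] R_rv[OF ij(2)]
  show "(\<lambda>\<omega>. \<bar>sqdist p (X i \<omega>) (X j \<omega>) - (sqdist p (Y i \<omega>) (Y j \<omega>)
      + v * ((R i \<omega>)\<^sup>2 + (R j \<omega>)\<^sup>2))\<bar>) \<in> borel_measurable M"
    by measurable
qed

lemma borel_measurable_norm_Z:
  "i < n \<Longrightarrow> (\<lambda>\<omega>. L2_set (Z i \<omega>) {..<p}) \<in> borel_measurable M"
  by (intro borel_measurable_L2_set_Rp borel_measurable_coord)

text \<open>
  The last inequality bounds the variance of \<open>|Z\<^sub>i|\<close> independently of the dimension.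
\<close>

lemma norm_Z_moments:
  assumes i: "i < n"
  defines "\<mu> \<equiv> expectation (\<lambda>\<omega>. L2_set (Z i \<omega>) {..<p})"
  shows "0 \<le> \<mu>" "\<mu>\<^sup>2 \<le> v * real p" "v * real p - \<mu>\<^sup>2 \<le> tail_moment g"
proof -
  note [measurable] = borel_measurable_norm_Z[OF i]
  have int: "integrable M (\<lambda>\<omega>. L2_set (Z i \<omega>) {..<p})"
    by (rule square_integrable_imp_integrable) (use Z_sq_integrable[OF i] in auto)
  show "0 \<le> \<mu>"
    unfolding \<mu>_def by (intro integral_nonneg_AE) auto
  have var: "variance (\<lambda>\<omega>. L2_set (Z i \<omega>) {..<p}) = v * real p - \<mu>\<^sup>2"
    using variance_eq[OF int Z_sq_integrable[OF i]] Z_sq[OF i] by (simp add: \<mu>_def)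
  then show "\<mu>\<^sup>2 \<le> v * real p"
    using variance_positive[of "\<lambda>\<omega>. L2_set (Z i \<omega>) {..<p}"] by simp
  have "variance (\<lambda>\<omega>. L2_set (Z i \<omega>) {..<p}) \<le> tail_moment g"
    unfolding tail_moment_def
    by (rule second_moment_le_tail_sum[OF _ Z_conc[OF i lipschitz1_norm] g_summable]) auto
  then show "v * real p - \<mu>\<^sup>2 \<le> tail_moment g" using var by simp
qed

lemma indep_var_diff_Y_Z:
  assumes i: "i < n" and j: "j < n" and l: "l < n"
  shows "indep_var (Rp p) (\<lambda>\<omega>. \<lambda>k\<in>{..<p}. Y i \<omega> k - Y j \<omega> k) (Rp p) (Z l)"
proof -
  let ?PN = "\<Pi>\<^sub>M i\<in>{..<n}. Rp p"
  have comp: "(\<lambda>y. y i) \<in> ?PN \<rightarrow>\<^sub>M Rp p" if "i < n" for i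
    using that by (intro measurable_component_singleton) auto
  have diff: "(\<lambda>y. \<lambda>k\<in>{..<p}. y i k - y j k) \<in> ?PN \<rightarrow>\<^sub>M Rp p"
    using measurable_Rp_component[OF comp[OF i]] measurable_Rp_component[OF comp[OF j]]
    by (intro measurable_Rp_restrict borel_measurable_diff) auto
  show ?thesis
    using indep_var_compose[OF YZ_indep diff comp[OF l]] i j l by (simp add: comp_def)
qed

lemma indep_var_Z_Z:
  assumes "i < n" "j < n" "i \<noteq> j"
  shows "indep_var (Rp p) (Z i) (Rp p) (Z j)"
proof -
  have "indep_var (Rp p) ((\<lambda>f. f i) \<circ> (\<lambda>\<omega>. \<lambda>i\<in>{i}. Z i \<omega>)) (Rp p) ((\<lambda>f. f j) \<circ> (\<lambda>\<omega>. \<lambda>i\<in>{j}. Z i \<omega>))"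
    using assms by (intro indep_var_compose[OF indep_var_restrict[OF Z_indep]]) auto
  then show ?thesis by (simp add: comp_def)
qed

lemma max_gap_tail:
  assumes n: "2 \<le> n" and p: "0 < p" and s: "1 \<le> s" and Rmax: "1 \<le> Rmax" "Rmax \<le> m"
    and Mp: "sqrt Mp \<le> m" and q1: "m * Rmax * s / sqrt (real p) \<le> 1"
  shows "prob {\<omega>\<in>space M. max_gap n p v (\<lambda>i. X i \<omega>) (\<lambda>i. Y i \<omega>) (\<lambda>i. R i \<omega>)
            > (8 + 6 * sqrt v + 2 * tail_moment g) * (m * Rmax * s / sqrt (real p))}
    \<le> prob {\<omega>\<in>space M. \<not> max_sqdist n p (\<lambda>i. Y i \<omega>) \<le> Mp} + 3 * (real n)\<^sup>2 * g s"
proof -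
  let ?N = "\<lambda>z. L2_set z {..<p}"
  define \<beta> where "\<beta> = (sqrt v + 1) * sqrt (real p)"
  \<comment> \<open>The three deviations, each of probability at most \<open>g s\<close>. The event \<open>A3\<close> depends on the
    first index only; it is indexed by pairs so that one union bound covers all three.\<close>
  define A1 where "A1 = (\<lambda>(i, j). {\<omega>\<in>space M. ?N (\<lambda>k. Y i \<omega> k - Y j \<omega> k) \<le> m
      \<and> m * s < \<bar>\<Sum>k<p. (Y i \<omega> k - Y j \<omega> k) * Z i \<omega> k\<bar>})"
  define A2 where "A2 = (\<lambda>(i, j). {\<omega>\<in>space M. ?N (Z i \<omega>) \<le> \<beta>
      \<and> \<beta> * s < \<bar>\<Sum>k<p. Z i \<omega> k * Z j \<omega> k\<bar>})"
  define A3 where "A3 = (\<lambda>(i, j :: nat). {\<omega>\<in>space M.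
      \<bar>?N (Z i \<omega>) - expectation (\<lambda>\<omega>. ?N (Z i \<omega>))\<bar> > s})"
  define A where "A = (\<lambda>ij. A1 ij \<union> A2 ij \<union> A3 ij)"
  define B where "B = {\<omega>\<in>space M. \<not> max_sqdist n p (\<lambda>i. Y i \<omega>) \<le> Mp}"
  have s0: "s > 0" using s by simp
  have v: "0 \<le> v"
    using norm_Z_moments(2)[of 0] n p zero_le_power2 order_trans zero_le_mult_iff
    by (metis not_less of_nat_0_less_iff order_less_le_trans zero_less_numeral)
  have V: "0 \<le> tail_moment g"
    using norm_Z_moments(2,3)[of 0] n by linarith
  have \<beta>: "\<beta> > 0" using p v by (simp add: \<beta>_def add_nonneg_pos)
  have m: "m > 0" using Rmax by simp
  have A1: "A1 (i, j) \<in> events" "prob (A1 (i, j)) \<le> g s" if "(i, j) \<in> offdiag n" for i j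
  proof -
    have ij: "i < n" "j < n" "i \<noteq> j" using that by (auto simp: offdiag_def)
    have [measurable]: "(\<lambda>\<omega>. ?N (\<lambda>k. Y i \<omega> k - Y j \<omega> k)) \<in> borel_measurable M"
      "(\<lambda>\<omega>. \<Sum>k<p. (Y i \<omega> k - Y j \<omega> k) * Z i \<omega> k) \<in> borel_measurable M"
      by (intro borel_measurable_L2_set_Rp borel_measurable_inner_Rp borel_measurable_diff
          borel_measurable_coord ij; assumption)+
    show "A1 (i, j) \<in> events"
      unfolding A1_def prod.case by measurable
    have "prob {\<omega>\<in>space M. ?N (\<lambda>k\<in>{..<p}. Y i \<omega> k - Y j \<omega> k) \<le> m
      \<and> m * s < \<bar>\<Sum>k<p. (\<lambda>k\<in>{..<p}. Y i \<omega> k - Y j \<omega> k) k * Z i \<omega> k\<bar>} \<le> g s"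
      using ij m s0
      by (intro indep_inner_tail indep_var_diff_Y_Z Z_integrable Z_mean Z_conc) auto
    also have "{\<omega>\<in>space M. ?N (\<lambda>k\<in>{..<p}. Y i \<omega> k - Y j \<omega> k) \<le> m
      \<and> m * s < \<bar>\<Sum>k<p. (\<lambda>k\<in>{..<p}. Y i \<omega> k - Y j \<omega> k) k * Z i \<omega> k\<bar>} = A1 (i, j)"
      unfolding A1_def by (simp add: L2_set_def)
    finally show "prob (A1 (i, j)) \<le> g s" .
  qed
  have A2: "A2 (i, j) \<in> events" "prob (A2 (i, j)) \<le> g s" if "(i, j) \<in> offdiag n" for i j
  proof -
    have ij: "i < n" "j < n" "i \<noteq> j" using that by (auto simp: offdiag_def)
    note [measurable] = borel_measurable_norm_Z[OF ij(1)]
    have [measurable]: "(\<lambda>\<omega>. \<Sum>k<p. Z i \<omega> k * Z j \<omega> k) \<in> borel_measurable M"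
      by (intro borel_measurable_inner_Rp borel_measurable_coord ij; assumption)+
    show "A2 (i, j) \<in> events"
      unfolding A2_def prod.case by measurable
    show "prob (A2 (i, j)) \<le> g s"
      unfolding A2_def prod.case using ij \<beta> s0
      by (intro indep_inner_tail indep_var_Z_Z Z_integrable Z_mean Z_conc) auto
  qed
  have A3: "A3 (i, j) \<in> events" "prob (A3 (i, j)) \<le> g s" if "(i, j) \<in> offdiag n" for i j
  proof -
    have i: "i < n" using that by (auto simp: offdiag_def)
    note [measurable] = borel_measurable_norm_Z[OF i]
    show "A3 (i, j) \<in> events"
      unfolding A3_def prod.case by measurable
    show "prob (A3 (i, j)) \<le> g s"
      unfolding A3_def prod.case by (rule Z_conc[OF i lipschitz1_norm s0])
  qed
  have A: "A ij \<in> events" "prob (A ij) \<le> 3 * g s" if "ij \<in> offdiag n" for ij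
  proof -
    obtain i j where ij: "ij = (i, j)" by (cases ij)
    note * = A1[OF that[unfolded ij]] A2[OF that[unfolded ij]] A3[OF that[unfolded ij]]
    show "A ij \<in> events" using * by (auto simp: A_def ij)
    have "prob (A ij) \<le> prob (A1 (i, j)) + prob (A2 (i, j)) + prob (A3 (i, j))"
      unfolding A_def ij using *
      by (intro order_trans[OF measure_Un_le] add_right_mono
          measure_Un_le) auto
    with * show "prob (A ij) \<le> 3 * g s" by simp
  qed
  have g0: "0 \<le> g s"
    using n by (intro order_trans[OF measure_nonneg A1(2)[of 0 1]]) (simp add: offdiag_def)
  have B: "B \<in> events"
    unfolding B_def using borel_measurable_max_sqdist by measurable
  have "AE \<omega> in M. \<forall>i\<in>{..<n}. \<bar>R i \<omega>\<bar> \<le> Rmax"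
    by (rule AE_finite_allI) (use R_le in auto)
  then have AE: "AE \<omega> in M. \<omega> \<in> {\<omega>\<in>space M. max_gap n p v (\<lambda>i. X i \<omega>) (\<lambda>i. Y i \<omega>) (\<lambda>i. R i \<omega>)
            > (8 + 6 * sqrt v + 2 * tail_moment g) * (m * Rmax * s / sqrt (real p))}
      \<longrightarrow> \<omega> \<in> B \<union> (\<Union>ij\<in>offdiag n. A ij)"
  proof eventually_elim
    case (elim \<omega>)
    show ?case
    proof (rule impI, rule ccontr)
      assume "\<omega> \<in> {\<omega>\<in>space M. max_gap n p v (\<lambda>i. X i \<omega>) (\<lambda>i. Y i \<omega>) (\<lambda>i. R i \<omega>)
            > (8 + 6 * sqrt v + 2 * tail_moment g) * (m * Rmax * s / sqrt (real p))}"
      then have \<omega>: "\<omega> \<in> space M" and gap: "max_gap n p v (\<lambda>i. X i \<omega>) (\<lambda>i. Y i \<omega>) (\<lambda>i. R i \<omega>)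
            > (8 + 6 * sqrt v + 2 * tail_moment g) * (m * Rmax * s / sqrt (real p))" by auto
      assume "\<omega> \<notin> B \<union> (\<Union>ij\<in>offdiag n. A ij)"
      then have nB: "max_sqdist n p (\<lambda>i. Y i \<omega>) \<le> Mp"
        and nA: "\<And>i j. (i, j) \<in> offdiag n \<Longrightarrow> \<omega> \<notin> A1 (i, j) \<and> \<omega> \<notin> A2 (i, j) \<and> \<omega> \<notin> A3 (i, j)"
        using \<omega> by (auto simp: B_def A_def)
      have Ydist: "?N (\<lambda>k. Y i \<omega> k - Y j \<omega> k) \<le> m" if "(i, j) \<in> offdiag n" for i j
      proof -
        have "sqdist p (Y i \<omega>) (Y j \<omega>) \<le> Mp"
          using nB that unfolding max_sqdist_def MAX_offdiag_le_iff[OF n] by auto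
        then have "?N (\<lambda>k. Y i \<omega> k - Y j \<omega> k) \<le> sqrt Mp"
          unfolding sqdist_def by (rule real_le_rsqrt)
        with Mp show ?thesis by simp
      qed
      have YZ: "\<bar>\<Sum>k<p. (Y i \<omega> k - Y j \<omega> k) * Z i \<omega> k\<bar> \<le> m * s" if "(i, j) \<in> offdiag n" for i j
        using nA[OF that] Ydist[OF that] \<omega> by (auto simp: A1_def)
      have Zdev: "\<bar>?N (Z i \<omega>) - expectation (\<lambda>\<omega>. ?N (Z i \<omega>))\<bar> \<le> s" if "i < n" for i
      proof -
        have "(i, if i = 0 then 1 else 0) \<in> offdiag n"
          using n that by (auto simp: offdiag_def)
        from nA[OF this] show ?thesis using \<omega> by (auto simp: A3_def)
      qed
      have mu: "expectation (\<lambda>\<omega>. ?N (Z i \<omega>)) \<le> sqrt (v * real p)" if "i < n" for i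
        using norm_Z_moments(2)[OF that] by (rule real_le_rsqrt)
      have sp: "s \<le> sqrt (real p)"
      proof -
        have "1 * s \<le> m * Rmax * s"
          using Rmax s mult_mono[of 1 m 1 Rmax] by (intro mult_right_mono) auto
        also have "\<dots> \<le> sqrt (real p)"
          using q1 p by (simp add: divide_le_eq)
        finally show ?thesis by simp
      qed
      \<comment> \<open>Hence the constraint \<open>|Z\<^sub>i| \<le> \<beta>\<close> in \<open>A2\<close> is satisfied.\<close>
      have Znorm: "?N (Z i \<omega>) \<le> \<beta>" if "i < n" for i
        using Zdev[OF that] mu[OF that] sp by (simp add: \<beta>_def algebra_simps real_sqrt_mult)
      have ZZ: "\<bar>\<Sum>k<p. Z i \<omega> k * Z j \<omega> k\<bar> \<le> \<beta> * s" if "(i, j) \<in> offdiag n" for i j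
        using nA[OF that] Znorm[of i] that \<omega> by (auto simp: A2_def offdiag_def)
      have Zsq: "\<bar>(?N (Z i \<omega>))\<^sup>2 - v * real p\<bar> \<le> s * (s + 2 * sqrt (v * real p)) + tail_moment g" if "i < n" for i
      proof -
        define \<mu> where "\<mu> = expectation (\<lambda>\<omega>. ?N (Z i \<omega>))"
        note mom = norm_Z_moments[OF that, folded \<mu>_def]
        have dev: "\<bar>?N (Z i \<omega>) - \<mu>\<bar> \<le> s" using Zdev[OF that] by (simp add: \<mu>_def)
        have "\<bar>?N (Z i \<omega>) + \<mu>\<bar> \<le> s + 2 * sqrt (v * real p)"
          using dev mu[OF that] mom(1) L2_set_nonneg[of "Z i \<omega>" "{..<p}"]
          unfolding \<mu>_def[symmetric] by linarith
        then have "\<bar>?N (Z i \<omega>) - \<mu>\<bar> * \<bar>?N (Z i \<omega>) + \<mu>\<bar> \<le> s * (s + 2 * sqrt (v * real p))"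
          using dev s0 by (intro mult_mono) auto
        then have "\<bar>(?N (Z i \<omega>))\<^sup>2 - \<mu>\<^sup>2\<bar> \<le> s * (s + 2 * sqrt (v * real p))"
          by (simp add: abs_mult[symmetric] power2_eq_square algebra_simps)
        with mom(2,3) show ?thesis by linarith
      qed
      have "max_gap n p v (\<lambda>i. X i \<omega>) (\<lambda>i. Y i \<omega>) (\<lambda>i. R i \<omega>)
          \<le> (8 + 6 * sqrt v + 2 * tail_moment g) * (m * Rmax * s / sqrt (real p))"
        unfolding max_gap_def MAX_offdiag_le_iff[OF n]
      proof safe
        fix i j assume ij: "(i, j) \<in> offdiag n"
        then have ji: "(j, i) \<in> offdiag n" and i: "i < n" and j: "j < n" by (auto simp: offdiag_def)
        \<comment> \<open>The pairing with \<open>Z\<^sub>j\<close> is covered by the deviation event of the pair \<open>(j, i)\<close>.\<close>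
        have "(\<Sum>k<p. (Y i \<omega> k - Y j \<omega> k) * Z j \<omega> k) = - (\<Sum>k<p. (Y j \<omega> k - Y i \<omega> k) * Z j \<omega> k)"
          by (simp add: sum_negf[symmetric] algebra_simps)
        then have YZ': "\<bar>\<Sum>k<p. (Y i \<omega> k - Y j \<omega> k) * Z j \<omega> k\<bar> \<le> m * s"
          using YZ[OF ji] by simp
        show "\<bar>sqdist p (X i \<omega>) (X j \<omega>) - (sqdist p (Y i \<omega>) (Y j \<omega>) + v * ((R i \<omega>)\<^sup>2 + (R j \<omega>)\<^sup>2))\<bar>
          \<le> (8 + 6 * sqrt v + 2 * tail_moment g) * (m * Rmax * s / sqrt (real p))"
          by (rule perturbation_bound[OF p s Rmax v V q1 _ _ _ _ YZ[OF ij] YZ'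
                ZZ[OF ij, unfolded \<beta>_def] Zsq[OF i] Zsq[OF j]])
            (use elim i j X_eq \<omega> in auto)
      qed
      with gap show False by simp
    qed
  qed
  have "prob {\<omega>\<in>space M. max_gap n p v (\<lambda>i. X i \<omega>) (\<lambda>i. Y i \<omega>) (\<lambda>i. R i \<omega>)
            > (8 + 6 * sqrt v + 2 * tail_moment g) * (m * Rmax * s / sqrt (real p))}
      \<le> prob (B \<union> (\<Union>ij\<in>offdiag n. A ij))"
    using AE by (rule finite_measure_mono_AE) (use A B in auto)
  also have "\<dots> \<le> prob B + prob (\<Union>ij\<in>offdiag n. A ij)"
    using A B by (intro measure_Un_le) auto
  also have "prob (\<Union>ij\<in>offdiag n. A ij) \<le> (\<Sum>ij\<in>offdiag n. prob (A ij))"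
    using A by (intro finite_measure_subadditive_finite) auto
  also have "\<dots> \<le> real (card (offdiag n)) * (3 * g s)"
    using A by (intro sum_bounded_above) auto
  also have "\<dots> \<le> (real n)\<^sup>2 * (3 * g s)"
    using card_offdiag_le[of n] g0 by (intro mult_right_mono) (simp_all flip: of_nat_power)
  finally show ?thesis by (simp add: B_def)
qed

end

section \<open>Kernel matrices\<close>

lemma sqdist_self [simp]: "sqdist p x x = 0"
  by (simp add: sqdist_def L2_set_def)

lemma sqdist_nonneg: "0 \<le> sqdist p x y"
  by (simp add: sqdist_def)

lemma frobenius_norm_le:
  assumes "\<And>i j. i < n \<Longrightarrow> j < n \<Longrightarrow> \<bar>A $$ (i, j)\<bar> \<le> c / real n"
    and "A \<in> carrier_mat n n" and c: "0 \<le> c"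
  shows "frobenius_norm A \<le> c"
proof -
  have "(\<Sum>i<n. \<Sum>j<n. (A $$ (i, j))\<^sup>2) \<le> (\<Sum>i<n. \<Sum>j<n. (c / real n)\<^sup>2)"
    using assms(1) by (intro sum_mono) (metis abs_ge_zero lessThan_iff power2_abs power_mono)
  also have "\<dots> \<le> c\<^sup>2"
    by (cases "n = 0") (simp_all add: power2_eq_square)
  finally show ?thesis
    unfolding frobenius_norm_def using assms(2) c by (auto intro: real_le_lsqrt sum_nonneg)
qed

text \<open>
  The interval is widened by \<open>\<eta>\<close> on both sides so that it contains the squared distances of \<open>x\<close>
  as well as their approximations.
\<close>

lemma frobenius_kernel_diff_le:
  assumes n: "2 \<le> n" and v: "0 \<le> v" and rlow: "0 \<le> rlow"
    and Y_max: "max_sqdist n p y \<le> Mp" and Y_min: "W \<le> min_sqdist n p y"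
    and r: "\<And>i. i < n \<Longrightarrow> \<bar>r i\<bar> \<in> {rlow..Rmax}"
    and gap: "max_gap n p v x y r \<le> \<eta>"
    and f: "C-lipschitz_on {W + 2 * v * rlow\<^sup>2 - \<eta>..Mp + 2 * v * Rmax\<^sup>2 + \<eta>} f"
  shows "frobenius_norm (kernel_mat n p f x - approx_kernel_mat n p f v y r)
    \<le> C * max_gap n p v x y r"
proof -
  let ?I = "{W + 2 * v * rlow\<^sup>2 - \<eta>..Mp + 2 * v * Rmax\<^sup>2 + \<eta>}"
  let ?G = "max_gap n p v x y r"
  define a where "a = (\<lambda>i j. sqdist p (x i) (x j))"
  define b where "b = (\<lambda>i j. sqdist p (y i) (y j) + v * ((r i)\<^sup>2 + (r j)\<^sup>2))"
  have C: "0 \<le> C" using f by (rule lipschitz_on_nonneg)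
  have G: "\<bar>a i j - b i j\<bar> \<le> ?G" if "(i, j) \<in> offdiag n" for i j
    using MAX_offdiag_le_iff[OF n, of "\<lambda>i j. \<bar>a i j - b i j\<bar>" ?G] that
    by (auto simp: max_gap_def a_def b_def)
  have "(0, 1) \<in> offdiag n" using n by (simp add: offdiag_def)
  from G[OF this] have G0: "0 \<le> ?G" by linarith
  have f_diff: "\<bar>f (a i j) - f (b i j)\<bar> \<le> C * ?G" if "(i, j) \<in> offdiag n" for i j
  proof -
    have ij: "i < n" "j < n" using that by (auto simp: offdiag_def)
    have dist: "W \<le> sqdist p (y i) (y j)" "sqdist p (y i) (y j) \<le> Mp"
      using Y_min Y_max that
      unfolding min_sqdist_def max_sqdist_def MIN_offdiag_ge_iff[OF n] MAX_offdiag_le_iff[OF n]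
      by auto
    have sq: "rlow\<^sup>2 \<le> (r i)\<^sup>2" "(r i)\<^sup>2 \<le> Rmax\<^sup>2" if "i < n" for i
      using power_mono[of rlow "\<bar>r i\<bar>" 2] power_mono[of "\<bar>r i\<bar>" Rmax 2] r[OF that] rlow
      by auto
    have "2 * v * rlow\<^sup>2 \<le> v * ((r i)\<^sup>2 + (r j)\<^sup>2)"
      using mult_left_mono[OF add_mono[OF sq(1)[OF ij(1)] sq(1)[OF ij(2)]] v] by simp
    moreover have "v * ((r i)\<^sup>2 + (r j)\<^sup>2) \<le> 2 * v * Rmax\<^sup>2"
      using mult_left_mono[OF add_mono[OF sq(2)[OF ij(1)] sq(2)[OF ij(2)]] v] by simp
    ultimately have "W + 2 * v * rlow\<^sup>2 \<le> b i j" "b i j \<le> Mp + 2 * v * Rmax\<^sup>2"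
      using dist by (auto simp: b_def)
    then have "a i j \<in> ?I" "b i j \<in> ?I"
      using G[OF that] G0 gap by auto
    then have "\<bar>f (a i j) - f (b i j)\<bar> \<le> C * \<bar>a i j - b i j\<bar>"
      using lipschitz_onD[OF f] by (auto simp: dist_real_def)
    also have "\<dots> \<le> C * ?G"
      using G[OF that] C by (rule mult_left_mono)
    finally show ?thesis .
  qed
  show ?thesis
  proof (rule frobenius_norm_le)
    show "kernel_mat n p f x - approx_kernel_mat n p f v y r \<in> carrier_mat n n"
      unfolding kernel_mat_def approx_kernel_mat_def by (intro minus_carrier_mat mat_carrier)
    show "0 \<le> C * ?G" using C G0 by simp
  next
    fix i j assume ij: "i < n" "j < n"
    show "\<bar>(kernel_mat n p f x - approx_kernel_mat n p f v y r) $$ (i, j)\<bar> \<le> C * ?G / real n"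
    proof (cases "i = j")
      case True
      then show ?thesis
        using ij C G0 by (simp add: kernel_mat_def approx_kernel_mat_def)
    next
      case False
      then have "(kernel_mat n p f x - approx_kernel_mat n p f v y r) $$ (i, j)
          = (f (a i j) - f (b i j)) / real n"
        using ij by (simp add: kernel_mat_def approx_kernel_mat_def a_def b_def diff_divide_distrib)
      then show ?thesis
        using f_diff[of i j] ij False by (simp add: offdiag_def divide_right_mono)
    qed
  qed
qed

lemma (in prob_space) prob_not:
  assumes "{\<omega>\<in>space M. P \<omega>} \<in> events"
  shows "prob {\<omega>\<in>space M. \<not> P \<omega>} = 1 - prob {\<omega>\<in>space M. P \<omega>}"
proof -
  have "{\<omega>\<in>space M. \<not> P \<omega>} = space M - {\<omega>\<in>space M. P \<omega>}" by auto
  with prob_compl[OF assms] show ?thesis by simp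
qed

section \<open>Convergence in probability\<close>

text \<open>
  The scale \<open>s\<close> solves \<open>c s\<^sup>b = 3 ln n\<close>, so the tail at \<open>s\<close> is \<open>C / n\<^sup>3\<close>, which outweighs
  the \<open>n\<^sup>2\<close> pairs. It is of the order that the rate hypothesis allows.
\<close>

lemma deviation_scale:
  fixes n :: "nat \<Rightarrow> nat" and c b C \<epsilon> :: real
  assumes n: "filterlim n at_top sequentially" and c: "c > 0" and b: "b > 0"
  defines "s \<equiv> \<lambda>k. (3 / c * ln (real (n k))) powr (1 / b)"
  shows "eventually (\<lambda>k. 1 \<le> s k) sequentially"
    and "eventually (\<lambda>k. s k \<le> (3 / c) powr (1 / b)
      * (ln (real (n k)) + ln (real (n k)) powr \<epsilon>) powr (1 / b)) sequentially"
    and "(\<lambda>k. 3 * (real (n k))\<^sup>2 * (C * exp (- c * s k powr b))) \<longlonglongrightarrow> 0"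
proof -
  have ln_n: "filterlim (\<lambda>k. ln (real (n k))) at_top sequentially"
    by (intro filterlim_compose[OF ln_at_top] filterlim_compose[OF filterlim_real_sequentially] n)
  have "eventually (\<lambda>k. c / 3 \<le> ln (real (n k))) sequentially"
    using ln_n unfolding filterlim_at_top by blast
  then show "eventually (\<lambda>k. 1 \<le> s k) sequentially"
    by eventually_elim (use c b in \<open>auto simp: s_def field_simps intro!: ge_one_powr_ge_zero\<close>)
  have pos: "eventually (\<lambda>k. 0 < ln (real (n k))) sequentially"
    using ln_n unfolding filterlim_at_top_dense by blast
  show "eventually (\<lambda>k. s k \<le> (3 / c) powr (1 / b)
      * (ln (real (n k)) + ln (real (n k)) powr \<epsilon>) powr (1 / b)) sequentially"
    using pos
  proof eventually_elim
    case (elim k)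
    then show ?case
      unfolding s_def using c b
      by (subst powr_mult) (auto intro!: mult_left_mono powr_mono2)
  qed
  have "(\<lambda>k. 3 * C / real (n k)) \<longlonglongrightarrow> 0"
    by (intro tendsto_divide_0[OF tendsto_const] filterlim_at_top_imp_at_infinity
        filterlim_compose[OF filterlim_real_sequentially] n)
  moreover have "eventually (\<lambda>k. 3 * C / real (n k)
      = 3 * (real (n k))\<^sup>2 * (C * exp (- c * s k powr b))) sequentially"
    using pos
  proof eventually_elim
    case (elim k)
    then have nk: "real (n k) > 0" by (metis ln_0 less_irrefl of_nat_0_less_iff neq0_conv of_nat_0)
    have "s k powr b = 3 / c * ln (real (n k))"
      using elim c b by (simp add: s_def powr_powr)
    then have "exp (- c * s k powr b) = exp (- (3 * ln (real (n k))))"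
      using c by simp
    also have "\<dots> = inverse ((real (n k)) ^ 3)"
      using nk exp_of_nat_mult[of 3 "ln (real (n k))"] by (simp add: exp_minus)
    finally show ?case
      using nk by (simp add: field_simps power2_eq_square power3_eq_cube)
  qed
  ultimately show "(\<lambda>k. 3 * (real (n k))\<^sup>2 * (C * exp (- c * s k powr b))) \<longlonglongrightarrow> 0"
    by (rule Lim_transform_eventually)
qed

theorem theorem2p2:
  fixes n p :: "nat \<Rightarrow> nat"
    and M :: "nat \<Rightarrow> 'a measure"
    and X Y Z :: "nat \<Rightarrow> nat \<Rightarrow> 'a \<Rightarrow> (nat \<Rightarrow> real)"
    and R :: "nat \<Rightarrow> nat \<Rightarrow> 'a \<Rightarrow> real"
    and \<nu> :: "nat \<Rightarrow> real"
    and r\<^sub>i\<^sub>n\<^sub>f R\<^sub>i\<^sub>n\<^sub>f \<M> :: "nat \<Rightarrow> real"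
    and C c\<^sub>0 b \<epsilon> :: real
  assumes n_lim: "filterlim n at_top sequentially"
    and p_lim: "filterlim p at_top sequentially"
    and prob: "\<And>k. prob_space (M k)"
    and X_def: "\<And>k i \<omega>. i < n k \<Longrightarrow> \<omega> \<in> space (M k) \<Longrightarrow>
          X k i \<omega> = (\<lambda>j\<in>{..<p k}. Y k i \<omega> j + R k i \<omega> * (Z k i \<omega> j / sqrt (real (p k))))"
    \<comment> \<open>(i)\<close>
    and Y_rv: "\<And>k i. i < n k \<Longrightarrow> Y k i \<in> M k \<rightarrow>\<^sub>M Rp (p k)"
    and Z_rv: "\<And>k i. i < n k \<Longrightarrow> Z k i \<in> M k \<rightarrow>\<^sub>M Rp (p k)"
    and R_rv: "\<And>k i. i < n k \<Longrightarrow> R k i \<in> borel_measurable (M k)"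
    and Z_indep: "\<And>k. prob_space.indep_vars (M k) (\<lambda>i. Rp (p k)) (Z k) {..<n k}"
    and Z_ident: "\<And>k i j. i < n k \<Longrightarrow> j < n k \<Longrightarrow>
          distr (M k) (Rp (p k)) (Z k i) = distr (M k) (Rp (p k)) (Z k j)"
    and Z_integrable: "\<And>k i j. i < n k \<Longrightarrow> j < p k \<Longrightarrow> integrable (M k) (\<lambda>\<omega>. Z k i \<omega> j)"
    and Z_mean: "\<And>k i j. i < n k \<Longrightarrow> j < p k \<Longrightarrow> (\<integral>\<omega>. Z k i \<omega> j \<partial>M k) = 0"
    and YZ_indep: "\<And>k. prob_space.indep_var (M k)
          (\<Pi>\<^sub>M i\<in>{..<n k}. Rp (p k)) (\<lambda>\<omega>. \<lambda>i\<in>{..<n k}. Y k i \<omega>)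
          (\<Pi>\<^sub>M i\<in>{..<n k}. Rp (p k)) (\<lambda>\<omega>. \<lambda>i\<in>{..<n k}. Z k i \<omega>)"
    and RZ_indep: "\<And>k. prob_space.indep_set (M k)
          (sets (vimage_algebra (space (M k)) (\<lambda>\<omega>. \<lambda>i\<in>{..<n k}. R k i \<omega>)
            (\<Pi>\<^sub>M i\<in>{..<n k}. borel)))
          (sets (vimage_algebra (space (M k)) (\<lambda>\<omega>. \<lambda>i\<in>{..<n k}. Z k i \<omega>)
            (\<Pi>\<^sub>M i\<in>{..<n k}. Rp (p k))))"
    \<comment> \<open>(ii)\<close>
    and consts_pos: "C > 0" "c\<^sub>0 > 0" "b > 0"
    and Z_conc: "\<And>k i F r. i < n k \<Longrightarrow> lipschitz1 (p k) F \<Longrightarrow> r > 0 \<Longrightarrow>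
          measure (M k) {\<omega>\<in>space (M k). \<bar>F (Z k i \<omega>) - (\<integral>\<omega>'. F (Z k i \<omega>') \<partial>M k)\<bar> > r}
            \<le> C * exp (- c\<^sub>0 * r powr b)"
    \<comment> \<open>(iii)\<close>
    and Z_sq_integrable: "\<And>k i. i < n k \<Longrightarrow>
          integrable (M k) (\<lambda>\<omega>. (L2_set (Z k i \<omega>) {..<p k})\<^sup>2)"
    and nu_eq: "\<And>k i. i < n k \<Longrightarrow>
          \<nu> k = (\<integral>\<omega>. (L2_set (Z k i \<omega>) {..<p k})\<^sup>2 \<partial>M k) / real (p k)"
    and nu_bounded: "Bseq \<nu>"
    \<comment> \<open>(iv)\<close>
    and R_range: "\<And>k i. i < n k \<Longrightarrow> AE \<omega> in M k. \<bar>R k i \<omega>\<bar> \<in> {r\<^sub>i\<^sub>n\<^sub>f (p k)..R\<^sub>i\<^sub>n\<^sub>f (p k)}"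
    and r_inf_nonneg: "\<And>k. r\<^sub>i\<^sub>n\<^sub>f (p k) \<ge> 0"
    and R_inf_ge_1: "\<And>k. R\<^sub>i\<^sub>n\<^sub>f (p k) \<ge> 1"
    \<comment> \<open>(v)\<close>
    and M_bound: "(\<lambda>k. measure (M k) {\<omega>\<in>space (M k).
          max_sqdist (n k) (p k) (\<lambda>i. Y k i \<omega>) \<le> \<M> (p k)}) \<longlonglongrightarrow> 1"
    and eps_pos: "\<epsilon> > 0"
    and rate: "(\<lambda>k. max (sqrt (\<M> (p k))) (R\<^sub>i\<^sub>n\<^sub>f (p k)) *
          (R\<^sub>i\<^sub>n\<^sub>f (p k) * (ln (real (n k)) + ln (real (n k)) powr \<epsilon>) powr (1 / b)
            / sqrt (real (p k)))) \<longlonglongrightarrow> 0"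
  shows "tendsto0_prob M (\<lambda>k \<omega>. MAX (i, j)\<in>offdiag (n k).
           \<bar>sqdist (p k) (X k i \<omega>) (X k j \<omega>)
             - (sqdist (p k) (Y k i \<omega>) (Y k j \<omega>) + \<nu> k * ((R k i \<omega>)\<^sup>2 + (R k j \<omega>)\<^sup>2))\<bar>)
    \<and> (\<lambda>k. measure (M k) {\<omega>\<in>space (M k).
              min_sqdist (n k) (p k) (\<lambda>i. Y k i \<omega>) \<ge> 0}) \<longlonglongrightarrow> 1
    \<and> (\<forall>(\<W> :: nat \<Rightarrow> real) (C\<^sub>1 :: real) (\<eta> :: real).
           (\<lambda>k. measure (M k) {\<omega>\<in>space (M k).
              min_sqdist (n k) (p k) (\<lambda>i. Y k i \<omega>) \<ge> \<W> (p k)}) \<longlonglongrightarrow> 1 \<longrightarrow>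
           C\<^sub>1 > 0 \<longrightarrow> \<eta> > 0 \<longrightarrow>
           tendsto0_outer_prob M (\<lambda>k \<omega>.
             SUP f\<in>{f :: real \<Rightarrow> real. C\<^sub>1-lipschitz_on
                     {\<W> (p k) + 2 * \<nu> k * (r\<^sub>i\<^sub>n\<^sub>f (p k))\<^sup>2 - \<eta> ..
                      \<M> (p k) + 2 * \<nu> k * (R\<^sub>i\<^sub>n\<^sub>f (p k))\<^sup>2 + \<eta>} f}.
               ennreal (frobenius_norm
                 (kernel_mat (n k) (p k) f (\<lambda>i. X k i \<omega>)
                  - approx_kernel_mat (n k) (p k) f (\<nu> k) (\<lambda>i. Y k i \<omega>) (\<lambda>i. R k i \<omega>)))))"
proof -
  let ?g = "\<lambda>r. C * exp (- c\<^sub>0 * r powr b)"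
  let ?gap = "\<lambda>k \<omega>. max_gap (n k) (p k) (\<nu> k) (\<lambda>i. X k i \<omega>) (\<lambda>i. Y k i \<omega>) (\<lambda>i. R k i \<omega>)"
  let ?Rm = "\<lambda>k. R\<^sub>i\<^sub>n\<^sub>f (p k)"
  have sample: "perturbed_sample (M k) (n k) (p k) (X k) (Y k) (Z k) (R k) (\<nu> k) (?Rm k) ?g" for k
  proof -
    interpret prob_space "M k" by (rule prob)
    show ?thesis
    proof (unfold_locales, goal_cases)
      case (1 i j \<omega>)
      then show ?case by (simp add: X_def)
    next
      \<comment> \<open>In dimension \<open>0\<close> the quotient defining \<open>\<nu>\<close> is \<open>0\<close>, and so is the second moment.\<close>
      case (12 i)
      then show ?case
        using nu_eq[of i k] by (cases "p k = 0") (simp_all add: L2_set_def)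
    next
      case (13 i)
      from R_range[OF this] show ?case by eventually_elim simp
    qed (use Y_rv Z_rv R_rv Z_indep Z_integrable Z_mean YZ_indep Z_conc Z_sq_integrable
        summable_stretched_exp[OF consts_pos(2,3)] in auto)
  qed
  have n2: "eventually (\<lambda>k. 2 \<le> n k) sequentially"
    using n_lim unfolding filterlim_at_top by blast
  have p0: "eventually (\<lambda>k. 1 \<le> p k) sequentially"
    using p_lim unfolding filterlim_at_top by blast
  have \<nu>_nonneg: "0 \<le> \<nu> k" if "2 \<le> n k" for k
    using that by (subst nu_eq[of 0]) (auto intro!: divide_nonneg_nonneg integral_nonneg_AE)
  obtain vb where vb: "\<And>k. norm (\<nu> k) \<le> vb" and "0 < vb"
    using nu_bounded unfolding Bseq_def by blast
  define L where "L = (\<lambda>k. (ln (real (n k)) + ln (real (n k)) powr \<epsilon>) powr (1 / b))"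
  define m where "m = (\<lambda>k. max (sqrt (\<M> (p k))) (?Rm k))"
  define s where "s = (\<lambda>k. (3 / c\<^sub>0 * ln (real (n k))) powr (1 / b))"
  define q where "q = (\<lambda>k. m k * ?Rm k * s k / sqrt (real (p k)))"
  define K where "K = 8 + 6 * sqrt vb + 2 * tail_moment ?g"
  have scale: "eventually (\<lambda>k. 1 \<le> s k) sequentially"
    "eventually (\<lambda>k. s k \<le> (3 / c\<^sub>0) powr (1 / b) * L k) sequentially"
    "(\<lambda>k. 3 * (real (n k))\<^sup>2 * ?g (s k)) \<longlonglongrightarrow> 0"
    unfolding s_def L_def by (rule deviation_scale[OF n_lim consts_pos(2,3)])+
  have m1: "1 \<le> m k" for k
    using R_inf_ge_1[of k] by (auto simp: m_def le_max_iff_disj)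
  have q_lim: "q \<longlonglongrightarrow> 0"
  proof (rule tendsto_sandwich)
    show "eventually (\<lambda>k. 0 \<le> q k) sequentially"
      using m1 R_inf_ge_1 by (auto simp: q_def s_def intro!: always_eventually mult_nonneg_nonneg
          divide_nonneg_nonneg intro: order_trans[of 0 1])
    show "eventually (\<lambda>k. q k \<le> (3 / c\<^sub>0) powr (1 / b) * (m k * (?Rm k * L k / sqrt (real (p k)))))
        sequentially"
      using scale(2)
    proof eventually_elim
      case (elim k)
      have "m k * ?Rm k * s k / sqrt (real (p k))
          \<le> m k * ?Rm k * ((3 / c\<^sub>0) powr (1 / b) * L k) / sqrt (real (p k))"
        using elim m1[of k] R_inf_ge_1[of k]
        by (intro divide_right_mono mult_left_mono) auto
      then show ?case by (simp add: q_def mult_ac)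
    qed
    show "(\<lambda>k. (3 / c\<^sub>0) powr (1 / b) * (m k * (?Rm k * L k / sqrt (real (p k))))) \<longlonglongrightarrow> 0"
      using tendsto_mult_right_zero[OF rate] by (simp add: m_def L_def)
  qed simp
  have not_max: "(\<lambda>k. measure (M k) {\<omega>\<in>space (M k).
      \<not> max_sqdist (n k) (p k) (\<lambda>i. Y k i \<omega>) \<le> \<M> (p k)}) \<longlonglongrightarrow> 0"
  proof -
    have "measure (M k) {\<omega>\<in>space (M k). \<not> max_sqdist (n k) (p k) (\<lambda>i. Y k i \<omega>) \<le> \<M> (p k)}
      = 1 - measure (M k) {\<omega>\<in>space (M k). max_sqdist (n k) (p k) (\<lambda>i. Y k i \<omega>) \<le> \<M> (p k)}" for k
    proof -
      interpret perturbed_sample "M k" "n k" "p k" "X k" "Y k" "Z k" "R k" "\<nu> k" "?Rm k" ?g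
        by (rule sample)
      show ?thesis
        by (rule prob_not) (use borel_measurable_max_sqdist in measurable)
    qed
    then show ?thesis using tendsto_diff[OF tendsto_const[of 1] M_bound] by simp
  qed
  have gap_meas: "?gap k \<in> borel_measurable (M k)" for k
    by (rule perturbed_sample.borel_measurable_max_gap[OF sample])
  have gap_lim: "(\<lambda>k. measure (M k) {\<omega>\<in>space (M k). ?gap k \<omega> > \<delta>}) \<longlonglongrightarrow> 0" if \<delta>: "\<delta> > 0" for \<delta>
  proof (rule tendsto_sandwich[OF _ _ tendsto_const])
    have "eventually (\<lambda>k. K * q k < \<delta>) sequentially"
      using tendsto_mult_right_zero[OF q_lim, of K] \<delta> by (rule order_tendstoD)
    moreover have "eventually (\<lambda>k. q k < 1) sequentially"
      using q_lim by (rule order_tendstoD) simp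
    ultimately show "eventually (\<lambda>k. measure (M k) {\<omega>\<in>space (M k). ?gap k \<omega> > \<delta>}
      \<le> measure (M k) {\<omega>\<in>space (M k). \<not> max_sqdist (n k) (p k) (\<lambda>i. Y k i \<omega>) \<le> \<M> (p k)}
        + 3 * (real (n k))\<^sup>2 * ?g (s k)) sequentially"
      using n2 p0 scale(1)
    proof eventually_elim
      case (elim k)
      interpret perturbed_sample "M k" "n k" "p k" "X k" "Y k" "Z k" "R k" "\<nu> k" "?Rm k" ?g
        by (rule sample)
      note [measurable] = gap_meas
      have "0 \<le> q k"
        using m1[of k] R_inf_ge_1[of k] elim by (auto simp: q_def)
      moreover have "8 + 6 * sqrt (\<nu> k) + 2 * tail_moment ?g \<le> K"
        using vb[of k] by (simp add: K_def)
      ultimately have "(8 + 6 * sqrt (\<nu> k) + 2 * tail_moment ?g) * q k \<le> K * q k"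
        by (intro mult_right_mono)
      then have "measure (M k) {\<omega>\<in>space (M k). ?gap k \<omega> > \<delta>}
        \<le> measure (M k) {\<omega>\<in>space (M k). ?gap k \<omega>
            > (8 + 6 * sqrt (\<nu> k) + 2 * tail_moment ?g) * q k}"
        using elim by (intro finite_measure_mono) auto
      also have "\<dots> \<le> measure (M k) {\<omega>\<in>space (M k). \<not> max_sqdist (n k) (p k) (\<lambda>i. Y k i \<omega>) \<le> \<M> (p k)}
        + 3 * (real (n k))\<^sup>2 * ?g (s k)"
        unfolding q_def using elim R_inf_ge_1[of k]
        by (intro max_gap_tail) (auto simp: m_def q_def)
      finally show ?case .
    qed
    show "(\<lambda>k. measure (M k) {\<omega>\<in>space (M k). \<not> max_sqdist (n k) (p k) (\<lambda>i. Y k i \<omega>) \<le> \<M> (p k)}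
        + 3 * (real (n k))\<^sup>2 * ?g (s k)) \<longlonglongrightarrow> 0"
      using tendsto_add[OF not_max scale(3)] by simp
  qed simp
  have gap_nonneg: "0 \<le> ?gap k \<omega>" if "2 \<le> n k" for k \<omega>
  proof (rule ccontr)
    assume "\<not> 0 \<le> ?gap k \<omega>"
    then have "?gap k \<omega> \<le> ?gap k \<omega> \<and> ?gap k \<omega> < 0" by simp
    moreover have "(0, 1) \<in> offdiag (n k)" using that by (simp add: offdiag_def)
    ultimately show False
      unfolding max_gap_def MAX_offdiag_le_iff[OF that] by fastforce
  qed
  have part1: "tendsto0_prob M ?gap"
    unfolding tendsto0_prob_def
  proof (intro conjI allI impI gap_meas)
    fix \<delta> :: real assume \<delta>: "\<delta> > 0"
    have "eventually (\<lambda>k. measure (M k) {\<omega>\<in>space (M k). ?gap k \<omega> > \<delta>}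
        = measure (M k) {\<omega>\<in>space (M k). \<bar>?gap k \<omega>\<bar> > \<delta>}) sequentially"
      using n2 by eventually_elim (simp add: gap_nonneg)
    with gap_lim[OF \<delta>] show "(\<lambda>k. measure (M k) {\<omega>\<in>space (M k). \<bar>?gap k \<omega>\<bar> > \<delta>}) \<longlonglongrightarrow> 0"
      by (rule Lim_transform_eventually)
  qed
  have part2: "(\<lambda>k. measure (M k) {\<omega>\<in>space (M k).
      min_sqdist (n k) (p k) (\<lambda>i. Y k i \<omega>) \<ge> 0}) \<longlonglongrightarrow> 1"
  proof (rule tendsto_eventually)
    show "eventually (\<lambda>k. measure (M k) {\<omega>\<in>space (M k).
      min_sqdist (n k) (p k) (\<lambda>i. Y k i \<omega>) \<ge> 0} = 1) sequentially"
      using n2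
    proof eventually_elim
      case (elim k)
      then have "0 \<le> min_sqdist (n k) (p k) (\<lambda>i. Y k i \<omega>)" for \<omega>
        by (auto simp: min_sqdist_def MIN_offdiag_ge_iff sqdist_nonneg)
      then show ?case by (simp add: prob_space.prob_space[OF prob])
    qed
  qed
  have part3: "tendsto0_outer_prob M (\<lambda>k \<omega>.
             SUP f\<in>{f :: real \<Rightarrow> real. C\<^sub>1-lipschitz_on
                     {\<W> (p k) + 2 * \<nu> k * (r\<^sub>i\<^sub>n\<^sub>f (p k))\<^sup>2 - \<eta> ..
                      \<M> (p k) + 2 * \<nu> k * (R\<^sub>i\<^sub>n\<^sub>f (p k))\<^sup>2 + \<eta>} f}.
               ennreal (frobenius_norm
                 (kernel_mat (n k) (p k) f (\<lambda>i. X k i \<omega>)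
                  - approx_kernel_mat (n k) (p k) f (\<nu> k) (\<lambda>i. Y k i \<omega>) (\<lambda>i. R k i \<omega>))))"
    if W_bound: "(\<lambda>k. measure (M k) {\<omega>\<in>space (M k).
              min_sqdist (n k) (p k) (\<lambda>i. Y k i \<omega>) \<ge> \<W> (p k)}) \<longlonglongrightarrow> 1"
      and C1: "C\<^sub>1 > 0" and \<eta>: "\<eta> > 0" for \<W> :: "nat \<Rightarrow> real" and C\<^sub>1 \<eta> :: real
  proof -
    \<comment> \<open>On \<open>good\<close> the Frobenius norm is at most \<open>C\<^sub>1\<close> times the maximal error for all \<open>f\<close>
      simultaneously; elsewhere the trivial bound \<open>\<infinity>\<close> suffices.\<close>
    define good where "good = (\<lambda>k \<omega>. 2 \<le> n k
      \<and> max_sqdist (n k) (p k) (\<lambda>i. Y k i \<omega>) \<le> \<M> (p k)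
      \<and> \<W> (p k) \<le> min_sqdist (n k) (p k) (\<lambda>i. Y k i \<omega>)
      \<and> (\<forall>i\<in>{..<n k}. \<bar>R k i \<omega>\<bar> \<in> {r\<^sub>i\<^sub>n\<^sub>f (p k)..?Rm k}) \<and> ?gap k \<omega> \<le> \<eta>)"
    define D where "D = (\<lambda>k \<omega>. if good k \<omega> then ennreal (C\<^sub>1 * ?gap k \<omega>) else \<infinity>)"
    have D_meas: "D k \<in> borel_measurable (M k)" for k
    proof -
      interpret perturbed_sample "M k" "n k" "p k" "X k" "Y k" "Z k" "R k" "\<nu> k" "?Rm k" ?g
        by (rule sample)
      note [measurable] = gap_meas borel_measurable_max_sqdist borel_measurable_min_sqdist
      have [measurable]: "R k i \<in> borel_measurable (M k)" if "i \<in> {..<n k}" for i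
        using that R_rv by simp
      have "{\<omega>\<in>space (M k). good k \<omega>} \<in> events"
        unfolding good_def atLeastAtMost_iff by measurable
      then show ?thesis
        unfolding D_def by measurable
    qed
    show ?thesis
      unfolding tendsto0_outer_prob_def
    proof (intro exI[of _ D] conjI allI ballI impI D_meas)
      fix k \<omega>
      show "(SUP f\<in>{f :: real \<Rightarrow> real. C\<^sub>1-lipschitz_on
                     {\<W> (p k) + 2 * \<nu> k * (r\<^sub>i\<^sub>n\<^sub>f (p k))\<^sup>2 - \<eta> ..
                      \<M> (p k) + 2 * \<nu> k * (R\<^sub>i\<^sub>n\<^sub>f (p k))\<^sup>2 + \<eta>} f}.
               ennreal (frobenius_norm
                 (kernel_mat (n k) (p k) f (\<lambda>i. X k i \<omega>)
                  - approx_kernel_mat (n k) (p k) f (\<nu> k) (\<lambda>i. Y k i \<omega>) (\<lambda>i. R k i \<omega>)))) \<le> D k \<omega>"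
      proof (cases "good k \<omega>")
        case True
        have "frobenius_norm (kernel_mat (n k) (p k) f (\<lambda>i. X k i \<omega>)
            - approx_kernel_mat (n k) (p k) f (\<nu> k) (\<lambda>i. Y k i \<omega>) (\<lambda>i. R k i \<omega>))
          \<le> C\<^sub>1 * ?gap k \<omega>"
          if "C\<^sub>1-lipschitz_on {\<W> (p k) + 2 * \<nu> k * (r\<^sub>i\<^sub>n\<^sub>f (p k))\<^sup>2 - \<eta> ..
            \<M> (p k) + 2 * \<nu> k * (R\<^sub>i\<^sub>n\<^sub>f (p k))\<^sup>2 + \<eta>} f" for f
          by (rule frobenius_kernel_diff_le[OF _ _ _ _ _ _ _ that])
            (use True in \<open>auto simp: good_def \<nu>_nonneg r_inf_nonneg\<close>)
        with True show ?thesis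
          by (auto simp: D_def intro!: SUP_least ennreal_leI)
      qed (simp add: D_def)
    next
      fix \<delta> :: real assume \<delta>: "\<delta> > 0"
      have not_min: "(\<lambda>k. measure (M k) {\<omega>\<in>space (M k).
          \<not> \<W> (p k) \<le> min_sqdist (n k) (p k) (\<lambda>i. Y k i \<omega>)}) \<longlonglongrightarrow> 0"
      proof -
        have "measure (M k) {\<omega>\<in>space (M k). \<not> \<W> (p k) \<le> min_sqdist (n k) (p k) (\<lambda>i. Y k i \<omega>)}
          = 1 - measure (M k) {\<omega>\<in>space (M k). \<W> (p k) \<le> min_sqdist (n k) (p k) (\<lambda>i. Y k i \<omega>)}" for k
        proof -
          interpret perturbed_sample "M k" "n k" "p k" "X k" "Y k" "Z k" "R k" "\<nu> k" "?Rm k" ?g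
            by (rule sample)
          show ?thesis
            by (rule prob_not) (use borel_measurable_min_sqdist in measurable)
        qed
        then show ?thesis using tendsto_diff[OF tendsto_const[of 1] W_bound] by simp
      qed
      \<comment> \<open>A maximal error of at most \<open>\<theta>\<close> keeps \<open>good\<close> intact and makes \<open>D\<close> at most \<open>\<delta>\<close>.\<close>
      define \<theta> where "\<theta> = min \<eta> (\<delta> / C\<^sub>1)"
      have \<theta>: "\<theta> > 0" using \<eta> \<delta> C1 by (simp add: \<theta>_def)
      show "(\<lambda>k. measure (M k) {\<omega>\<in>space (M k). D k \<omega> > ennreal \<delta>}) \<longlonglongrightarrow> 0"
      proof (rule tendsto_sandwich[OF _ _ tendsto_const])
        show "eventually (\<lambda>k. measure (M k) {\<omega>\<in>space (M k). D k \<omega> > ennreal \<delta>}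
          \<le> measure (M k) {\<omega>\<in>space (M k). \<not> max_sqdist (n k) (p k) (\<lambda>i. Y k i \<omega>) \<le> \<M> (p k)}
            + measure (M k) {\<omega>\<in>space (M k). \<not> \<W> (p k) \<le> min_sqdist (n k) (p k) (\<lambda>i. Y k i \<omega>)}
            + measure (M k) {\<omega>\<in>space (M k). ?gap k \<omega> > \<theta>}) sequentially"
          using n2
        proof eventually_elim
          case (elim k)
          interpret perturbed_sample "M k" "n k" "p k" "X k" "Y k" "Z k" "R k" "\<nu> k" "?Rm k" ?g
            by (rule sample)
          note [measurable] = gap_meas borel_measurable_max_sqdist borel_measurable_min_sqdist
          let ?A = "{\<omega>\<in>space (M k). \<not> max_sqdist (n k) (p k) (\<lambda>i. Y k i \<omega>) \<le> \<M> (p k)}"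
          let ?B = "{\<omega>\<in>space (M k). \<not> \<W> (p k) \<le> min_sqdist (n k) (p k) (\<lambda>i. Y k i \<omega>)}"
          let ?E = "{\<omega>\<in>space (M k). ?gap k \<omega> > \<theta>}"
          have "AE \<omega> in M k. \<forall>i\<in>{..<n k}. \<bar>R k i \<omega>\<bar> \<in> {r\<^sub>i\<^sub>n\<^sub>f (p k)..?Rm k}"
            by (rule AE_finite_allI) (use R_range in auto)
          then have "AE \<omega> in M k. \<omega> \<in> {\<omega>\<in>space (M k). D k \<omega> > ennreal \<delta>} \<longrightarrow> \<omega> \<in> ?A \<union> ?B \<union> ?E"
          proof eventually_elim
            case R_in: (elim \<omega>)
            show ?case
            proof (intro impI, rule ccontr)
              assume "\<omega> \<in> {\<omega>\<in>space (M k). D k \<omega> > ennreal \<delta>}" "\<omega> \<notin> ?A \<union> ?B \<union> ?E"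
              then have D: "D k \<omega> > ennreal \<delta>" and small: "?gap k \<omega> \<le> \<theta>" and "good k \<omega>"
                using R_in elim by (auto simp: good_def \<theta>_def)
              then have "C\<^sub>1 * ?gap k \<omega> > \<delta>"
                using \<delta> by (simp add: D_def ennreal_less_iff)
              moreover have "C\<^sub>1 * ?gap k \<omega> \<le> \<delta>"
                using small C1 by (simp add: \<theta>_def field_simps)
              ultimately show False by simp
            qed
          qed
          then have "prob {\<omega>\<in>space (M k). D k \<omega> > ennreal \<delta>} \<le> prob (?A \<union> ?B \<union> ?E)"
            by (rule finite_measure_mono_AE) measurable
          also have "\<dots> \<le> prob (?A \<union> ?B) + prob ?E"
            by (rule measure_Un_le) measurable
          also have "prob (?A \<union> ?B) \<le> prob ?A + prob ?B"
            by (rule measure_Un_le) measurable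
          finally show ?case by simp
        qed
        show "(\<lambda>k. measure (M k) {\<omega>\<in>space (M k). \<not> max_sqdist (n k) (p k) (\<lambda>i. Y k i \<omega>) \<le> \<M> (p k)}
            + measure (M k) {\<omega>\<in>space (M k). \<not> \<W> (p k) \<le> min_sqdist (n k) (p k) (\<lambda>i. Y k i \<omega>)}
            + measure (M k) {\<omega>\<in>space (M k). ?gap k \<omega> > \<theta>}) \<longlonglongrightarrow> 0"
          using tendsto_add[OF tendsto_add[OF not_max not_min] gap_lim[OF \<theta>]] by simp
      qed simp
    qed
  qed
  show ?thesis
    using part1 part2 part3 unfolding max_gap_def by blast
qed

end
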